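(* Let $k\ge 1$ be an integer and, for each integer $N\ge 1$, let $h=1/N$, let $\mathcal{V}_h^k$ be the space defined in the context, and let $P=P_h:L^2(0,1)\to\mathcal{V}_h^k$ be the $L^2(0,1)$-orthogonal projection. (i) If $k=2\kappa+1$ with $\kappa\in\{0,1,2,\dots\}$ and $u\in C_p^{k+2}$, then there exists a constant $C_k>0$, independent of $h$ and of $u$, such that for every $N\ge 1$, $$\|P[(Pu-u)_x]\|\le C_k\,h^{k+1}\,\|u^{(k+2)}\|_\infty .$$ (ii) If $k=1$ and $u\in C_p^{5}$, then there exists a constant $C_1>0$, independent of $h$ and of $u$, such that for every $N\ge 1$, $$\|P[(Pu-u)_x]\|\le C_1\,h^{4}\,\|u^{(5)}\|_\infty .$$
   Context: $C_p$ denotes the space of continuous $1$-periodic functions $f:\mathbb{R}\to\mathbb{R}$, and $C_p^m$ the set of $f\in C_p$ whose derivatives $f^{(j)}$, $j=1,\dots,m$, also lie in $C_p$. For $N\ge1$, $h=1/N$ and nodes $x_i=ih$, $i\in\mathbb{Z}$ (a uniform $1$-periodic partition of $\mathbb{R}$). $\mathcal{V}_h^k=\{\phi\in C_p:\ \phi|_{[x_{i-1},x_i]}\text{ is a polynomial of degree at most }k\text{ for } i=1,\dots,N\}$ (continuous periodic Lagrange finite elements of degree $k$). $(\cdot,\cdot)$ and $\|\cdot\|$ are the inner product and norm of $L^2(0,1)$, and $\|\cdot\|_\infty$ is the sup norm. For $u\in C_p^1$, $(Pu-u)_x$ is the (piecewise defined, square-integrable) derivative of $Pu-u$. *)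

theory Defs
  imports "HOL-Analysis.Analysis" "HOL-Computational_Algebra.Polynomial"
begin

definition Cp :: "(real \<Rightarrow> real) set" where
  "Cp = {f. continuous_on UNIV f \<and> (\<forall>x. f (x + 1) = f x)}"

definition Cpm :: "nat \<Rightarrow> (real \<Rightarrow> real) set" where
  "Cpm m = {f. (\<forall>j<m. \<forall>x. ((deriv ^^ j) f) differentiable (at x)) \<and>
               (\<forall>j\<le>m. (deriv ^^ j) f \<in> Cp)}"

definition Vh :: "nat \<Rightarrow> nat \<Rightarrow> (real \<Rightarrow> real) set" where
  "Vh N k = {\<phi>. \<phi> \<in> Cp \<and>
     (\<forall>i\<in>{1..N}. \<exists>p :: real poly. degree p \<le> k \<and>
        (\<forall>x\<in>{real (i - 1) / real N .. real i / real N}. \<phi> x = poly p x))}"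

definition L2ip :: "(real \<Rightarrow> real) \<Rightarrow> (real \<Rightarrow> real) \<Rightarrow> real" where
  "L2ip f g = integral {0..1} (\<lambda>x. f x * g x)"

definition L2norm :: "(real \<Rightarrow> real) \<Rightarrow> real" where
  "L2norm f = sqrt (integral {0..1} (\<lambda>x. (f x)\<^sup>2))"

definition supnorm :: "(real \<Rightarrow> real) \<Rightarrow> real" where
  "supnorm f = (SUP x. \<bar>f x\<bar>)"

definition L2proj :: "nat \<Rightarrow> nat \<Rightarrow> (real \<Rightarrow> real) \<Rightarrow> (real \<Rightarrow> real)" where
  "L2proj N k f = (THE \<phi>. \<phi> \<in> Vh N k \<and> (\<forall>\<psi>\<in>Vh N k. L2ip (\<lambda>x. f x - \<phi> x) \<psi> = 0))"

text \<open>(Pu - u)_x: derivative of Pu - u (defined away from the mesh nodes, a null set).\<close>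
definition proj_err_deriv :: "nat \<Rightarrow> nat \<Rightarrow> (real \<Rightarrow> real) \<Rightarrow> (real \<Rightarrow> real)" where
  "proj_err_deriv N k u = deriv (\<lambda>y. L2proj N k u y - u y)"

end

theory Submission
  imports Defs
begin

text \<open>On a uniform mesh the projection error of \<open>u\<close> is, to leading order, a cellwise multiple of the
  monic Legendre polynomial of degree \<open>k + 1\<close>. For odd \<open>k\<close> this polynomial takes equal values at both
  ends of a cell, so adding the multiples to \<open>u\<close> leaves a function that continuous finite elements
  approximate to order \<open>h^(k+2)\<close>. The leading term is orthogonal to the derivatives of all test
  functions; integrating by parts and using the inverse inequality costs one power of \<open>h\<close>, which
  leaves \<open>h^(k+1)\<close>.

  For \<open>k = 1\<close> let \<open>A\<close> be the mass matrix with stencil \<open>(1, 4, 1)/6\<close>, and let \<open>G'' = u\<close>. Applying \<open>A\<close>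
  twice to the nodal values of \<open>P[(Pu - u)_x]\<close> eliminates \<open>Pu\<close> and leaves second differences of the
  error of Simpson's rule for \<open>G'\<close>. By Taylor expansion this is of order \<open>h^4\<close>, and \<open>A\<close> is
  stable in the maximum norm.\<close>

subsection \<open>Riesz representation\<close>

text \<open>\<open>L2proj\<close> is a definite description, so nothing follows about it before the
  projection is known to exist and to be unique. The elements are bare functions; a finite set of
  points on which only the zero element vanishes stands in for finite dimension. Parity enters at
  the nodes. The term \<open>c i * poly L s\<close> contributes the jump c(i+1) L(0) - c(i) L(1)
  there. If L(1) = L(0), only the difference of neighbouring coefficients survives, which is one
  power of h smaller than the coefficients; for even k, L(1) = - L(0) and the jump would stay of
  order h^(k+1). For k = 1 the nodal equations are translation-invariant stencils, and stencils
  commute: the second application of \<open>A\<close> therefore falls on the nodal values of Pu,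
  where the projection equation replaces it by data. The resulting combination annihilates
  polynomials G of degree 6, so its size is governed by the seventh derivative of G, the fifth of u.
  Of h^7, two powers are lost in writing moments of u through G and one in differentiating, which
  leaves h^4.\<close>

lemma riesz_separating_points:
  fixes W :: "('a \<Rightarrow> real) set" and B :: "('a \<Rightarrow> real) \<Rightarrow> ('a \<Rightarrow> real) \<Rightarrow> real"
  assumes fin: "finite S"
    and zeroW: "(\<lambda>x. 0) \<in> W"
    and combW: "\<And>f g a. f \<in> W \<Longrightarrow> g \<in> W \<Longrightarrow> (\<lambda>x. f x + a * g x) \<in> W"
    and sepW: "\<And>f. f \<in> W \<Longrightarrow> \<forall>x\<in>S. f x = 0 \<Longrightarrow> f = (\<lambda>x. 0)"
    and lin: "\<And>f g h a. f \<in> W \<Longrightarrow> g \<in> W \<Longrightarrow> h \<in> W \<Longrightarrow>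
           B (\<lambda>x. f x + a * g x) h = B f h + a * B g h"
    and sym: "\<And>f g. B f g = B g f"
    and pos: "\<And>f. f \<in> W \<Longrightarrow> B f f = 0 \<Longrightarrow> f = (\<lambda>x. 0)"
    and l: "\<And>f g a. f \<in> W \<Longrightarrow> g \<in> W \<Longrightarrow> l (\<lambda>x. f x + a * g x) = l f + a * l g"
  shows "\<exists>\<phi>\<in>W. \<forall>\<psi>\<in>W. B \<phi> \<psi> = l \<psi>"
proof -
  define sub where "sub V \<longleftrightarrow> V \<subseteq> W \<and> (\<lambda>x. 0) \<in> V \<and>
    (\<forall>f\<in>V. \<forall>g\<in>V. \<forall>a. (\<lambda>x. f x + a * g x) \<in> V)" for V
  define linear_on where "linear_on V m \<longleftrightarrow>
    (\<forall>f\<in>V. \<forall>g\<in>V. \<forall>a. m (\<lambda>x. f x + a * g x) = m f + a * m g)"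
    for V :: "('a \<Rightarrow> real) set" and m :: "('a \<Rightarrow> real) \<Rightarrow> real"
  \<comment> \<open>Induction over the separating points takes the place of a basis. All subspaces
    are covered because the step passes to the functions vanishing at the new point, which the
    remaining points separate. All functionals are covered because the hypothesis is applied to two
    of them, \<open>l\<close> and \<open>B b\<close>.\<close>
  have "\<forall>V m. sub V \<longrightarrow> (\<forall>f\<in>V. (\<forall>x\<in>S. f x = 0) \<longrightarrow> f = (\<lambda>x. 0)) \<longrightarrow> linear_on V m \<longrightarrow>
          (\<exists>\<phi>\<in>V. \<forall>\<psi>\<in>V. B \<phi> \<psi> = m \<psi>)"
    using fin
  proof (induction S rule: finite_induct)
    case empty
    show ?case
    proof (intro allI impI)
      fix V m assume sub: "sub V" and sep: "\<forall>f\<in>V. (\<forall>x\<in>{}. f x = 0) \<longrightarrow> f = (\<lambda>x. 0)"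
        and m: "linear_on V m"
      have 0: "(\<lambda>x. 0) \<in> V" using sub by (simp add: sub_def)
      have "m (\<lambda>x. 0) = 0"
        using m[unfolded linear_on_def, rule_format, OF 0 0, of 1] by simp
      moreover have "B (\<lambda>x. 0) (\<lambda>x. 0) = 0"
        using lin[OF zeroW zeroW zeroW, of 1] by simp
      ultimately have "B (\<lambda>x. 0) \<psi> = m \<psi>" if "\<psi> \<in> V" for \<psi>
        using sep that by simp
      then show "\<exists>\<phi>\<in>V. \<forall>\<psi>\<in>V. B \<phi> \<psi> = m \<psi>" using 0 by blast
    qed
  next
    case (insert x S)
    show ?case
    proof (intro allI impI)
      fix V l assume sub: "sub V" and sep: "\<forall>f\<in>V. (\<forall>x\<in>insert x S. f x = 0) \<longrightarrow> f = (\<lambda>x. 0)"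
        and l: "linear_on V l"
      have VW: "f \<in> W" if "f \<in> V" for f using that sub by (auto simp: sub_def)
      have comb: "(\<lambda>x. f x + a * g x) \<in> V" if "f \<in> V" "g \<in> V" for f g a
        using that sub by (auto simp: sub_def)
      define V0 where "V0 = {f \<in> V. f x = 0}"
      have V0V: "f \<in> V" if "f \<in> V0" for f using that by (simp add: V0_def)
      have sub0: "sub V0" using sub by (auto simp: sub_def V0_def)
      have sep0: "\<forall>f\<in>V0. (\<forall>x\<in>S. f x = 0) \<longrightarrow> f = (\<lambda>x. 0)"
        using sep by (auto simp: V0_def)
      have rep: "\<exists>\<phi>\<in>V0. \<forall>\<psi>\<in>V0. B \<phi> \<psi> = m \<psi>" if "linear_on V m" for m
      proof -
        have "linear_on V0 m" using that V0V unfolding linear_on_def by blast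
        then show ?thesis using insert.IH sub0 sep0 by blast
      qed
      obtain \<phi>0 where \<phi>0: "\<phi>0 \<in> V0" "\<And>\<psi>. \<psi> \<in> V0 \<Longrightarrow> B \<phi>0 \<psi> = l \<psi>"
        using rep[OF l] by blast
      show "\<exists>\<phi>\<in>V. \<forall>\<psi>\<in>V. B \<phi> \<psi> = l \<psi>"
      proof (cases "V0 = V")
        case True
        then show ?thesis using \<phi>0 by blast
      next
        case False
        then obtain b where b: "b \<in> V" "b x \<noteq> 0" by (auto simp: V0_def)
        have "linear_on V (B b)" unfolding linear_on_def
          using lin[OF VW VW VW[OF b(1)]] by (subst (1 2 3) sym) blast
        then obtain \<beta> where \<beta>: "\<beta> \<in> V0" "\<And>\<psi>. \<psi> \<in> V0 \<Longrightarrow> B \<beta> \<psi> = B b \<psi>"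
          using rep by blast
        \<comment> \<open>One Gram-Schmidt step: \<open>\<beta>\<close> represents
          \<open>B b\<close> on \<open>V0\<close>, so \<open>d\<close> is orthogonal to
          \<open>V0\<close>, and since \<open>d x\<close> is nonzero it spans a complement of
          \<open>V0\<close>. The representer on \<open>V0\<close> then only needs a multiple of
          \<open>d\<close> that fixes the value at \<open>d\<close>.\<close>
        define d where "d = (\<lambda>y. b y + (-1) * \<beta> y)"
        have dV: "d \<in> V" unfolding d_def using comb b(1) V0V[OF \<beta>(1)] by blast
        have dx: "d x \<noteq> 0" using b \<beta>(1) by (simp add: d_def V0_def)
        have Bd: "B d \<psi> = 0" if "\<psi> \<in> V0" for \<psi>
          using lin[OF VW[OF b(1)] VW[OF V0V[OF \<beta>(1)]] VW[OF V0V[OF that]], of "-1"] \<beta>(2)[OF that]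
          by (simp add: d_def)
        have Bdd: "B d d \<noteq> 0" using pos[OF VW[OF dV]] dx by auto
        define c where "c = (l d - B \<phi>0 d) / B d d"
        define \<phi> where "\<phi> = (\<lambda>y. \<phi>0 y + c * d y)"
        have \<phi>V: "\<phi> \<in> V" unfolding \<phi>_def using comb V0V[OF \<phi>0(1)] dV by blast
        have "B \<phi> \<psi> = l \<psi>" if \<psi>: "\<psi> \<in> V" for \<psi>
        proof -
          define t where "t = \<psi> x / d x"
          define \<psi>0 where "\<psi>0 = (\<lambda>y. \<psi> y + (-t) * d y)"
          have \<psi>0: "\<psi>0 \<in> V0"
            using comb[OF \<psi> dV, of "-t"] dx by (simp add: V0_def \<psi>0_def t_def)
          have eq: "\<psi> = (\<lambda>y. \<psi>0 y + t * d y)" by (simp add: \<psi>0_def)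
          have "B \<phi> \<psi> = B \<phi>0 \<psi> + c * B d \<psi>"
            unfolding \<phi>_def by (rule lin[OF VW[OF V0V[OF \<phi>0(1)]] VW[OF dV] VW[OF \<psi>]])
          also have "B \<phi>0 \<psi> = B \<phi>0 \<psi>0 + t * B \<phi>0 d"
            using lin[OF VW[OF V0V[OF \<psi>0]] VW[OF dV] VW[OF V0V[OF \<phi>0(1)]], of t]
            unfolding eq[symmetric] sym[of \<psi> \<phi>0] sym[of \<psi>0 \<phi>0] sym[of d \<phi>0] .
          also have "B d \<psi> = B d \<psi>0 + t * B d d"
            using lin[OF VW[OF V0V[OF \<psi>0]] VW[OF dV] VW[OF dV], of t]
            unfolding eq[symmetric] sym[of \<psi> d] sym[of \<psi>0 d] .
          also have "B \<phi>0 \<psi>0 + t * B \<phi>0 d + c * (B d \<psi>0 + t * B d d) = l \<psi>0 + t * l d"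
            using \<phi>0(2)[OF \<psi>0] Bd[OF \<psi>0] Bdd by (simp add: c_def field_simps)
          also have "\<dots> = l \<psi>"
          proof -
            have "l (\<lambda>y. \<psi>0 y + t * d y) = l \<psi>0 + t * l d"
              using l V0V[OF \<psi>0] dV unfolding linear_on_def by blast
            then show ?thesis unfolding eq[symmetric] by (rule HOL.sym)
          qed
          finally show ?thesis .
        qed
        then show ?thesis using \<phi>V by blast
      qed
    qed
  qed
  moreover have "sub W" unfolding sub_def using zeroW combW by blast
  moreover have "linear_on W l" unfolding linear_on_def using l by blast
  ultimately show ?thesis using sepW by blast
qed

subsection \<open>Reference cells\<close>

lemma Cp_shift_int:
  assumes "f \<in> Cp"
  shows "f (x + of_int n) = f x"
proof -
  have per: "f (y + 1) = f y" for y
    using assms by (simp add: Cp_def)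
  have nat: "f (y + real m) = f y" for y m
  proof (induction m)
    case (Suc m)
    then show ?case using per[of "y + real m"] by (simp add: algebra_simps)
  qed simp
  show ?thesis
  proof (cases "n \<ge> 0")
    case True
    then show ?thesis using nat[of x "nat n"] by simp
  next
    case False
    then show ?thesis using nat[of "x + of_int n" "nat (- n)"] by simp
  qed
qed

text \<open>Cells are addressed by an integer index and a local coordinate \<open>s\<close>.
  Periodicity becomes N-periodicity of the index, so that the neighbours of the first and the last
  cell need no special treatment.\<close>

lemma Cp_shift_cells:
  assumes "f \<in> Cp" "N \<ge> 1"
  shows "f ((of_int (i + n * int N) + s) / real N) = f ((of_int i + s) / real N)"
proof -
  have "(of_int (i + n * int N) + s) / real N = (of_int i + s) / real N + of_int n"
    using assms(2) by (simp add: field_simps)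
  then show ?thesis using Cp_shift_int[OF assms(1)] by simp
qed

lemma Cp_linear_combination:
  assumes "f \<in> Cp" "g \<in> Cp"
  shows "(\<lambda>x. f x + a * g x) \<in> Cp"
  using assms by (auto simp: Cp_def intro!: continuous_intros)

lemma Cp_continuous_on: "f \<in> Cp \<Longrightarrow> continuous_on S f"
  by (auto simp: Cp_def intro: continuous_on_subset)

lemma Vh_cell:
  assumes "\<phi> \<in> Vh N k" "N \<ge> 1"
  obtains p where "degree p \<le> k"
    "\<And>s. s \<in> {0..1} \<Longrightarrow> \<phi> ((of_int i + s) / real N) = poly p s"
proof -
  define j where "j = nat (i mod int N)"
  have j: "int j = i mod int N" "j < N" using assms(2) by (auto simp: j_def nat_less_iff)
  have \<phi>: "\<phi> \<in> Cp" using assms(1) by (simp add: Vh_def)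
  \<comment> \<open>The definition of \<open>Vh\<close> counts cells from 1, the local addressing
    from 0.\<close>
  have "Suc j \<in> {1..N}" using j by auto
  then obtain q where q: "degree q \<le> k"
    "\<And>x. x \<in> {real j / real N .. real (Suc j) / real N} \<Longrightarrow> \<phi> x = poly q x"
    using assms(1) unfolding Vh_def by fastforce
  define p where "p = pcompose q [:real j / real N, 1 / real N:]"
  show ?thesis
  proof
    show "degree p \<le> k"
      using q(1) degree_pcompose_le[of q "[:real j / real N, 1 / real N:]"] assms(2) by (simp add: p_def)
    fix s :: real assume s: "s \<in> {0..1}"
    have "i = int j + (i div int N) * int N" using j by simp
    then have "\<phi> ((of_int i + s) / real N) = \<phi> ((of_int (int j) + s) / real N)"
      using Cp_shift_cells[OF \<phi> assms(2)] by metis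
    also have "\<dots> = poly q ((real j + s) / real N)"
      using s assms(2) by (subst q(2)) (auto simp: field_simps)
    also have "\<dots> = poly p s" by (simp add: p_def poly_pcompose add_divide_distrib)
    finally show "\<phi> ((of_int i + s) / real N) = poly p s" .
  qed
qed

text \<open>Converse of the cellwise description, and the only source of elements other than zero,
  linear combinations and projections. Continuity is proved in the stretched variable, where cells
  are unit intervals: any point is interior to the union of two adjacent closed cells.\<close>

lemma Vh_glue:
  fixes p :: "int \<Rightarrow> real poly"
  assumes "N \<ge> 1" and deg: "\<And>i. degree (p i) \<le> k" and per: "\<And>i. p (i + int N) = p i"
    and match: "\<And>i. poly (p i) 1 = poly (p (i + 1)) 0"
  obtains \<phi> where "\<phi> \<in> Vh N k"
    "\<And>i s. s \<in> {0..1} \<Longrightarrow> \<phi> ((of_int i + s) / real N) = poly (p i) s"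
proof -
  define q where "q t = poly (p \<lfloor>t\<rfloor>) (frac t)" for t :: real
  define \<phi> where "\<phi> x = q (real N * x)" for x
  have q: "q (of_int i + s) = poly (p i) s" if "s \<in> {0..1}" for i s
  proof (cases "s = 1")
    case True
    then show ?thesis using match[of i] by (simp add: q_def frac_def)
  next
    case False
    then have "\<lfloor>of_int i + s\<rfloor> = i" using that by (simp add: floor_eq_iff)
    then show ?thesis by (simp add: q_def frac_def)
  qed
  have cont: "continuous_on {of_int i..of_int i + 1} q" for i
  proof -
    have "continuous_on {of_int i..of_int i + 1} (\<lambda>t. poly (p i) (t - of_int i))"
      by (intro continuous_intros)
    moreover have "poly (p i) (t - of_int i) = q t" if "t \<in> {of_int i..of_int i + 1}" for t
      using q[of "t - of_int i" i] that by auto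
    ultimately show ?thesis by (metis (no_types, lifting) continuous_on_cong)
  qed
  have "isCont q t" for t
  proof -
    \<comment> \<open>With the ceiling, \<open>t\<close> lies in the half-open interval from
      \<open>?m\<close> (excluded) to \<open>?m + 1\<close> (included), hence strictly inside the
      two cells even when it is an integer.\<close>
    let ?m = "\<lceil>t\<rceil> - 1"
    have "continuous_on ({of_int ?m..of_int ?m + 1} \<union> {of_int (?m + 1)..of_int (?m + 1) + 1}) q"
      by (intro continuous_on_closed_Un cont) auto
    moreover have "{of_int ?m..of_int ?m + 1} \<union> {of_int (?m + 1)..of_int (?m + 1) + 1} = {of_int ?m..of_int ?m + (2::real)}"
      by auto
    ultimately have "continuous_on {of_int ?m..of_int ?m + (2::real)} q" by simp
    moreover have "t \<in> interior {of_int ?m..of_int ?m + (2::real)}"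
      by (simp add: interior_atLeastAtMost_real) linarith
    ultimately show ?thesis by (rule continuous_on_interior)
  qed
  then have "continuous_on UNIV q" by (simp add: continuous_on_eq_continuous_at)
  then have "continuous_on UNIV \<phi>" unfolding \<phi>_def
    by (rule continuous_on_compose2) (auto intro!: continuous_intros)
  moreover have "\<phi> (x + 1) = \<phi> x" for x
  proof -
    have "real N * (x + 1) = real N * x + of_int (int N)" by (simp add: algebra_simps)
    moreover have "q (t + of_int (int N)) = q t" for t
      unfolding q_def frac_def floor_add_int[symmetric] by (simp add: per)
    ultimately show ?thesis by (simp only: \<phi>_def)
  qed
  ultimately have "\<phi> \<in> Cp" by (simp add: Cp_def)
  moreover have val: "\<phi> ((of_int i + s) / real N) = poly (p i) s" if "s \<in> {0..1}" for i s
    using q[OF that] assms(1) by (simp add: \<phi>_def)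
  have "\<exists>r. degree r \<le> k \<and> (\<forall>x\<in>{real (i - 1) / real N..real i / real N}. \<phi> x = poly r x)"
    if i1: "i \<in> {1..N}" for i
  proof -
    obtain j where i: "i = Suc j" using i1 by (cases i) auto
    define r where "r = pcompose (p (int j)) [:- real j, real N:]"
    have "degree r \<le> degree (p (int j)) * degree [:- real j, real N:]"
      unfolding r_def by (rule degree_pcompose_le)
    also have "\<dots> \<le> k" using assms(1) deg[of "int j"] by simp
    finally have "degree r \<le> k" .
    moreover have "\<phi> x = poly r x" if x: "x \<in> {real j / real N..real (Suc j) / real N}" for x
    proof -
      have "real N * x - real j \<in> {0..1}"
        using x assms(1) by (simp add: pos_divide_le_eq pos_le_divide_eq mult.commute)
      then have "\<phi> ((of_int (int j) + (real N * x - real j)) / real N) = poly (p (int j)) (real N * x - real j)"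
        by (rule val)
      moreover have "(of_int (int j) + (real N * x - real j)) / real N = x"
        using assms(1) by simp
      moreover have "poly r x = poly (p (int j)) (real N * x - real j)"
        by (simp add: r_def poly_pcompose mult.commute)
      ultimately show ?thesis by (simp only:)
    qed
    ultimately show ?thesis unfolding i by (intro exI[of _ r]) simp
  qed
  ultimately have "\<phi> \<in> Vh N k" unfolding Vh_def by simp
  then show ?thesis using val by (rule that)
qed

lemma has_integral_cells:
  fixes f :: "real \<Rightarrow> real"
  assumes N: "N \<ge> 1"
    and I: "\<And>i. i < N \<Longrightarrow> ((\<lambda>s. f ((real i + s) / real N)) has_integral I i) {0..1}"
  shows "(f has_integral (\<Sum>i<N. I i) / real N) {0..1}"
proof -
  have cell: "(f has_integral I i / real N) {real i / real N..real (Suc i) / real N}" if "i < N" for i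
  proof -
    have "(real i + s) / real N = (1 / real N) *\<^sub>R s + real i / real N" for s
      by (simp add: add_divide_distrib)
    then have "((\<lambda>s. f ((1 / real N) *\<^sub>R s + real i / real N)) has_integral I i) {0..1}"
      using I[OF that] by simp
    moreover have "(I i / real N) /\<^sub>R (1 / real N) ^ DIM(real) = I i"
      using N by simp
    moreover have "(real i / real N - real i / real N) /\<^sub>R (1 / real N) = 0"
      "(real (Suc i) / real N - real i / real N) /\<^sub>R (1 / real N) = 1"
      using N by (simp_all flip: diff_divide_distrib)
    moreover have "1 / real N > 0" using N by simp
    ultimately show ?thesis
      using has_integral_affinity_iff[of "1 / real N" f "real i / real N" "I i / real N"
          "real i / real N" "real (Suc i) / real N"] by (simp only: cbox_interval)
  qed
  have "(f has_integral (\<Sum>i<n. I i) / real N) {0..real n / real N}" if "n \<le> N" for n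
    using that
  proof (induction n)
    case (Suc n)
    have "(f has_integral (\<Sum>i<n. I i) / real N + I n / real N) {0..real (Suc n) / real N}"
    proof (rule has_integral_combine)
      show "real n / real N \<le> real (Suc n) / real N" by (intro divide_right_mono) auto
    qed (use Suc cell[of n] in auto)
    then show ?case by (simp add: add_divide_distrib)
  qed (simp add: has_integral_refl)
  from this[of N] show ?thesis using N by simp
qed

lemma L2ip_cells:
  assumes "N \<ge> 1"
    and "\<And>i. i < N \<Longrightarrow> ((\<lambda>s. f ((real i + s) / real N) * g ((real i + s) / real N)) has_integral I i) {0..1}"
  shows "L2ip f g = (\<Sum>i<N. I i) / real N"
  unfolding L2ip_def using has_integral_cells[OF assms(1), of "\<lambda>x. f x * g x" I] assms(2)
  by (auto intro: integral_unique)

subsection \<open>The \<open>L\<^sup>2\<close> projection\<close>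

lemma Vh_Cp: "\<phi> \<in> Vh N k \<Longrightarrow> \<phi> \<in> Cp"
  by (simp add: Vh_def)

lemma Vh_zero: "(\<lambda>x. 0) \<in> Vh N k"
  unfolding Vh_def Cp_def by (auto intro!: exI[of _ 0])

lemma Vh_linear_combination:
  assumes "f \<in> Vh N k" "g \<in> Vh N k"
  shows "(\<lambda>x. f x + a * g x) \<in> Vh N k"
proof -
  have "\<exists>r. degree r \<le> k \<and> (\<forall>x\<in>{real (i - 1) / real N..real i / real N}. f x + a * g x = poly r x)"
    if i: "i \<in> {1..N}" for i
  proof -
    obtain p q where "degree p \<le> k" "\<forall>x\<in>{real (i - 1) / real N..real i / real N}. f x = poly p x"
      and "degree q \<le> k" "\<forall>x\<in>{real (i - 1) / real N..real i / real N}. g x = poly q x"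
      using assms i unfolding Vh_def by blast
    then show ?thesis
      by (intro exI[of _ "p + smult a q"]) (auto intro!: degree_add_le order.trans[OF degree_smult_le])
  qed
  then show ?thesis
    using assms Cp_linear_combination unfolding Vh_def by blast
qed

text \<open>The points are the k + 1 equispaced Lagrange nodes of each cell, and a polynomial of
  degree at most k vanishing at all of them is zero. This provides the separating set for the Riesz
  argument.\<close>

lemma Vh_eq_zero_at_points:
  assumes N: "N \<ge> 1" and k: "k \<ge> 1" and \<phi>: "\<phi> \<in> Vh N k"
    and zero: "\<forall>x\<in>(\<lambda>(i, j). (real i + real j / real k) / real N) ` ({..<N} \<times> {..k}). \<phi> x = 0"
  shows "\<phi> = (\<lambda>x. 0)"
proof
  fix x
  define n where "n = \<lfloor>real N * x\<rfloor>"
  define i where "i = nat (n mod int N)"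
  have i: "int i = n mod int N" "i < N" using N by (auto simp: i_def nat_less_iff)
  obtain p where p: "degree p \<le> k" "\<And>s. s \<in> {0..1} \<Longrightarrow> \<phi> ((of_int (int i) + s) / real N) = poly p s"
    using Vh_cell[OF \<phi> N] by metis
  have "p = 0"
  proof (rule poly_eqI_degree)
    show "poly p s = poly 0 s" if "s \<in> (\<lambda>j. real j / real k) ` {..k}" for s
      using that zero i(2) k by (auto simp flip: p(2))
    have "card ((\<lambda>j. real j / real k) ` {..k}) = Suc k"
      using k by (subst card_image) (auto simp: inj_on_def)
    then show "degree p < card ((\<lambda>j. real j / real k) ` {..k})"
      "degree (0::real poly) < card ((\<lambda>j. real j / real k) ` {..k})"
      using p(1) by auto
  qed
  have "n = int i + (n div int N) * int N" using i by simp
  then have "\<phi> ((of_int n + frac (real N * x)) / real N) = \<phi> ((of_int (int i) + frac (real N * x)) / real N)"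
    using Cp_shift_cells[OF Vh_Cp[OF \<phi>] N] by metis
  also have "\<dots> = 0"
    using p(2)[of "frac (real N * x)"] \<open>p = 0\<close> frac_lt_1[of "real N * x"] by simp
  finally show "\<phi> x = 0" using N by (simp add: n_def frac_def)
qed

lemma L2ip_commute: "L2ip f g = L2ip g f"
  by (simp add: L2ip_def mult.commute)

lemma L2ip_linear:
  assumes "(\<lambda>x. f x * h x) integrable_on {0..1}" "(\<lambda>x. g x * h x) integrable_on {0..1}"
  shows "L2ip (\<lambda>x. f x + a * g x) h = L2ip f h + a * L2ip g h"
proof -
  have "((\<lambda>x. f x * h x + a * (g x * h x)) has_integral (L2ip f h + a * L2ip g h)) {0..1}"
    unfolding L2ip_def using assms
    by (intro has_integral_add has_integral_mult_right) (auto simp: integrable_integral)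
  then show ?thesis unfolding L2ip_def by (simp add: integral_unique algebra_simps)
qed

lemma continuous_mult_integrable:
  fixes f g :: "real \<Rightarrow> real"
  assumes "continuous_on {0..1} f" "continuous_on {0..1} g"
  shows "(\<lambda>x. f x * g x) integrable_on {0..1}"
  by (intro integrable_continuous_interval continuous_on_mult assms)

lemma L2ip_self_eq_zero:
  assumes "continuous_on {0..1} f" "L2ip f f = 0" "x \<in> {0..1}"
  shows "f x = 0"
proof -
  have "integral {0..1} (\<lambda>x. f x * f x) = 0 \<longleftrightarrow> (\<forall>x\<in>{0..1}. f x * f x = 0)"
    by (intro integral_eq_0_iff continuous_on_mult assms) auto
  then show ?thesis using assms by (simp add: L2ip_def)
qed

lemma Cp_L2ip_self_eq_zero:
  assumes "f \<in> Cp" "L2ip f f = 0"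
  shows "f = (\<lambda>x. 0)"
proof
  fix x
  have "f (frac x + of_int \<lfloor>x\<rfloor>) = f (frac x)" by (rule Cp_shift_int[OF assms(1)])
  also have "\<dots> = 0"
    using L2ip_self_eq_zero[OF Cp_continuous_on[OF assms(1)] assms(2), of "frac x"] frac_lt_1[of x] by simp
  finally show "f x = 0" by (simp add: frac_def)
qed

text \<open>Of \<open>f\<close> only integrability against the elements is asked, because the
  projection is applied both to the continuous u and to the derivative of Pu - u, which may jump at
  the nodes.\<close>

lemma L2proj:
  assumes N: "N \<ge> 1" and k: "k \<ge> 1"
    and int: "\<And>\<psi>. \<psi> \<in> Vh N k \<Longrightarrow> (\<lambda>x. f x * \<psi> x) integrable_on {0..1}"
  shows L2proj_in_Vh: "L2proj N k f \<in> Vh N k"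
    and L2ip_L2proj: "\<psi> \<in> Vh N k \<Longrightarrow> L2ip (L2proj N k f) \<psi> = L2ip f \<psi>"
proof -
  have intV: "(\<lambda>x. \<phi> x * \<psi> x) integrable_on {0..1}" if "\<phi> \<in> Vh N k" "\<psi> \<in> Vh N k" for \<phi> \<psi>
    using that by (intro continuous_mult_integrable Cp_continuous_on Vh_Cp)
  have lin: "L2ip (\<lambda>x. \<phi> x + a * \<psi> x) \<eta> = L2ip \<phi> \<eta> + a * L2ip \<psi> \<eta>"
    if "\<phi> \<in> Vh N k" "\<psi> \<in> Vh N k" "\<eta> \<in> Vh N k" for \<phi> \<psi> \<eta> a
    by (rule L2ip_linear[OF intV[OF that(1,3)] intV[OF that(2,3)]])
  have pos: "\<phi> = (\<lambda>x. 0)" if "\<phi> \<in> Vh N k" "L2ip \<phi> \<phi> = 0" for \<phi>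
    using Cp_L2ip_self_eq_zero[OF Vh_Cp[OF that(1)] that(2)] .
  have "\<exists>\<phi>\<in>Vh N k. \<forall>\<psi>\<in>Vh N k. L2ip \<phi> \<psi> = L2ip f \<psi>"
  proof (rule riesz_separating_points)
    show "finite ((\<lambda>(i, j). (real i + real j / real k) / real N) ` ({..<N} \<times> {..k}))" by simp
    show "L2ip f (\<lambda>x. \<phi> x + a * \<psi> x) = L2ip f \<phi> + a * L2ip f \<psi>"
      if "\<phi> \<in> Vh N k" "\<psi> \<in> Vh N k" for \<phi> \<psi> a
      unfolding L2ip_commute[of f _]
      by (rule L2ip_linear) (use int[OF that(1)] int[OF that(2)] in \<open>simp_all add: mult.commute\<close>)
    show "\<phi> = (\<lambda>x. 0)"
      if "\<phi> \<in> Vh N k"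
        "\<forall>x\<in>(\<lambda>(i, j). (real i + real j / real k) / real N) ` ({..<N} \<times> {..k}). \<phi> x = 0" for \<phi>
      by (rule Vh_eq_zero_at_points[OF N k that])
    show "L2ip f g = L2ip g f" for f g by (rule L2ip_commute)
  qed (rule Vh_zero Vh_linear_combination lin pos; assumption)+
  then obtain \<phi> where \<phi>: "\<phi> \<in> Vh N k" "\<And>\<psi>. \<psi> \<in> Vh N k \<Longrightarrow> L2ip \<phi> \<psi> = L2ip f \<psi>"
    by blast
  have diff: "L2ip (\<lambda>x. f x - \<eta> x) \<psi> = L2ip f \<psi> - L2ip \<eta> \<psi>"
    if "\<eta> \<in> Vh N k" "\<psi> \<in> Vh N k" for \<eta> \<psi>
    using L2ip_linear[of f \<psi> \<eta> "-1"] int[OF that(2)] intV[OF that] by simp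
  have uniq: "\<eta> = \<phi>" if "\<eta> \<in> Vh N k" "\<forall>\<psi>\<in>Vh N k. L2ip (\<lambda>x. f x - \<eta> x) \<psi> = 0" for \<eta>
  proof -
    let ?d = "\<lambda>x. \<eta> x + (-1) * \<phi> x"
    have d: "?d \<in> Vh N k" by (intro Vh_linear_combination that \<phi>)
    have "L2ip ?d ?d = L2ip \<eta> ?d + (-1) * L2ip \<phi> ?d"
      by (intro lin that \<phi> d)
    also have "\<dots> = 0" using that(2) diff[OF that(1) d] d \<phi>(2)[OF d] by simp
    finally show ?thesis using pos[OF d] by (simp add: fun_eq_iff)
  qed
  have "L2proj N k f = \<phi>" unfolding L2proj_def
  proof (rule the_equality)
    show "\<phi> \<in> Vh N k \<and> (\<forall>\<psi>\<in>Vh N k. L2ip (\<lambda>x. f x - \<phi> x) \<psi> = 0)"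
      using diff[OF \<phi>(1)] \<phi> by simp
    show "\<eta> = \<phi>" if "\<eta> \<in> Vh N k \<and> (\<forall>\<psi>\<in>Vh N k. L2ip (\<lambda>x. f x - \<eta> x) \<psi> = 0)" for \<eta>
      using uniq that by blast
  qed
  then show "L2proj N k f \<in> Vh N k" "\<psi> \<in> Vh N k \<Longrightarrow> L2ip (L2proj N k f) \<psi> = L2ip f \<psi>"
    using \<phi> by simp_all
qed

subsection \<open>Polynomials on the unit interval\<close>

lemma poly_zero_on_unit_interval:
  fixes p :: "real poly"
  assumes "\<And>s. s \<in> {0..1} \<Longrightarrow> poly p s = 0"
  shows "p = 0"
proof (rule ccontr)
  assume "p \<noteq> 0"
  then have "finite {s. poly p s = 0}" by (rule poly_roots_finite)
  moreover have "{0..1} \<subseteq> {s. poly p s = 0}" using assms by auto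
  ultimately have "finite {0..1::real}" by (rule rev_finite_subset)
  then show False using infinite_Icc[of 0 "1::real"] by simp
qed

lemma poly_L2ip_self_eq_zero:
  fixes p :: "real poly"
  assumes "L2ip (poly p) (poly p) = 0"
  shows "p = 0"
  by (rule poly_zero_on_unit_interval, rule L2ip_self_eq_zero[OF _ assms])
    (auto intro!: continuous_intros)

lemma poly_mult_integrable:
  "(\<lambda>x. poly p x * poly q x) integrable_on {0..1::real}"
  by (intro continuous_mult_integrable continuous_intros)

lemma L2ip_poly_linear:
  "L2ip (poly (p + smult a q)) (poly r) = L2ip (poly p) (poly r) + a * L2ip (poly q) (poly r)"
proof -
  have "poly (p + smult a q) = (\<lambda>x. poly p x + a * poly q x)" by (simp add: fun_eq_iff)
  then show ?thesis
    by (simp only: L2ip_linear[OF poly_mult_integrable poly_mult_integrable])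
qed

text \<open>Since \<open>poly\<close> is injective over the reals, functionals on polynomials can be
  read as functionals on functions, with 0, ..., k as separating points. Two functionals matter
  later: a single coefficient, and the inner product with the monomial of degree k + 1.\<close>

lemma poly_riesz:
  fixes l :: "real poly \<Rightarrow> real"
  assumes l: "\<And>p q a. degree p \<le> k \<Longrightarrow> degree q \<le> k \<Longrightarrow> l (p + smult a q) = l p + a * l q"
  obtains r where "degree r \<le> k" "\<And>p. degree p \<le> k \<Longrightarrow> L2ip (poly r) (poly p) = l p"
proof -
  define W where "W = (poly :: real poly \<Rightarrow> real \<Rightarrow> real) ` {p. degree p \<le> k}"
  have inj: "inj (poly :: real poly \<Rightarrow> real \<Rightarrow> real)"
    by (auto intro!: injI simp: poly_eq_poly_eq_iff)
  have comb: "(\<lambda>x. poly p x + a * poly q x) = poly (p + smult a q)" for p q :: "real poly" and a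
    by (simp add: fun_eq_iff)
  have deg: "degree (p + smult a q) \<le> k" if "degree p \<le> k" "degree q \<le> k" for p q :: "real poly" and a
    using that by (intro degree_add_le order.trans[OF degree_smult_le])
  have "\<exists>\<phi>\<in>W. \<forall>\<psi>\<in>W. L2ip \<phi> \<psi> = l (inv poly \<psi>)"
  proof (rule riesz_separating_points)
    show "finite (real ` {..k})" by simp
    show "(\<lambda>x. 0) \<in> W" unfolding W_def by (rule image_eqI[of _ _ 0]) auto
    show "(\<lambda>x. f x + a * g x) \<in> W" if fg: "f \<in> W" "g \<in> W" for f g a
    proof -
      obtain p q where "degree p \<le> k" "degree q \<le> k" "f = poly p" "g = poly q"
        using fg by (auto simp: W_def)
      then show ?thesis unfolding W_def using deg by (simp add: comb)
    qed
    show "f = (\<lambda>x. 0)" if f: "f \<in> W" "\<forall>x\<in>real ` {..k}. f x = 0" for f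
    proof -
      obtain p where p: "degree p \<le> k" "f = poly p" using f(1) by (auto simp: W_def)
      have "p = 0"
        by (rule poly_eqI_degree[of "real ` {..k}"]) (use p f(2) in \<open>auto simp: card_image\<close>)
      then show ?thesis using p by (simp add: fun_eq_iff)
    qed
    show "L2ip (\<lambda>x. f x + a * g x) h = L2ip f h + a * L2ip g h"
      if fgh: "f \<in> W" "g \<in> W" "h \<in> W" for f g h a
    proof -
      obtain p q r where "f = poly p" "g = poly q" "h = poly r"
        using fgh by (auto simp: W_def)
      then show ?thesis by (simp only: comb L2ip_poly_linear)
    qed
    show "L2ip f g = L2ip g f" for f g by (rule L2ip_commute)
    show "f = (\<lambda>x. 0)" if f: "f \<in> W" "L2ip f f = 0" for f
    proof -
      obtain p where p: "f = poly p" using f(1) by (auto simp: W_def)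
      then have "p = 0" using f(2) poly_L2ip_self_eq_zero by blast
      then show ?thesis using p by (simp add: fun_eq_iff)
    qed
    show "l (inv poly (\<lambda>x. f x + a * g x)) = l (inv poly f) + a * l (inv poly g)"
      if fg: "f \<in> W" "g \<in> W" for f g a
    proof -
      obtain p q where "degree p \<le> k" "degree q \<le> k" "f = poly p" "g = poly q"
        using fg by (auto simp: W_def)
      then show ?thesis by (simp only: comb inv_f_f[OF inj] l)
    qed
  qed
  then obtain r where r: "degree r \<le> k" "\<forall>\<psi>\<in>W. L2ip (poly r) \<psi> = l (inv poly \<psi>)"
    by (auto simp: W_def)
  have "L2ip (poly r) (poly p) = l p" if "degree p \<le> k" for p
  proof -
    have "poly p \<in> W" using that by (simp add: W_def)
    then show ?thesis using r(2) by (simp add: inv_f_f[OF inj])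
  qed
  then show ?thesis using r(1) that by blast
qed

text \<open>Equivalence of norms in finite dimension, obtained from duality: each coefficient
  functional has a representer \<open>r\<close>, and Cauchy-Schwarz, in the form of a nonnegative
  variance, bounds the coefficient by the maximum of \<open>(poly r x)\<^sup>2\<close> on the unit
  interval.\<close>

lemma coeff_bound_L2:
  obtains R where "R > 0" "\<And>p j. degree p \<le> k \<Longrightarrow> (coeff p j)\<^sup>2 \<le> R * L2ip (poly p) (poly p)"
proof -
  have "\<exists>R>0. \<forall>p. degree p \<le> k \<longrightarrow> (coeff p j)\<^sup>2 \<le> R * L2ip (poly p) (poly p)" for j
  proof -
    obtain r :: "real poly" where r: "\<And>p. degree p \<le> k \<Longrightarrow> L2ip (poly r) (poly p) = coeff p j"
      using poly_riesz[of k "\<lambda>p. coeff p j"] by (metis coeff_add coeff_smult)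
    have "compact ((\<lambda>x. (poly r x)\<^sup>2) ` {0..1})"
      by (intro compact_continuous_image continuous_intros) auto
    then obtain M where M: "\<And>x. x \<in> {0..1} \<Longrightarrow> (poly r x)\<^sup>2 \<le> M"
      by (force dest!: compact_imp_bounded simp: bounded_iff)
    have "(coeff p j)\<^sup>2 \<le> (\<bar>M\<bar> + 1) * L2ip (poly p) (poly p)" if p: "degree p \<le> k" for p
    proof -
      define m where "m = coeff p j"
      \<comment> \<open>the variance of \<open>r p\<close> under the uniform measure on the unit interval\<close>
      have "((\<lambda>x. (poly (r * p) x)\<^sup>2 - 2 * m * (poly r x * poly p x) + m\<^sup>2) has_integral
          (integral {0..1} (\<lambda>x. (poly (r * p) x)\<^sup>2) - 2 * m * m + m\<^sup>2)) {0..1}"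
      proof (intro has_integral_add has_integral_diff has_integral_mult_right)
        show "((\<lambda>x. (poly (r * p) x)\<^sup>2) has_integral integral {0..1} (\<lambda>x. (poly (r * p) x)\<^sup>2)) {0..1}"
          by (intro integrable_integral integrable_continuous_interval continuous_intros)
        show "((\<lambda>x. poly r x * poly p x) has_integral m) {0..1}"
          using integrable_integral[OF poly_mult_integrable[of r p]] r[OF p] by (simp add: L2ip_def m_def)
        show "((\<lambda>x::real. m\<^sup>2) has_integral m\<^sup>2) {0..1}"
          using has_integral_const_real[of "m\<^sup>2" 0 1] by simp
      qed
      then have "integral {0..1} (\<lambda>x. (poly (r * p) x)\<^sup>2) - 2 * m * m + m\<^sup>2 \<ge> 0"
      proof (rule has_integral_nonneg)
        fix x :: real
        have "0 \<le> (poly (r * p) x - m)\<^sup>2" by simp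
        then show "0 \<le> (poly (r * p) x)\<^sup>2 - 2 * m * (poly r x * poly p x) + m\<^sup>2"
          by (simp add: power2_eq_square algebra_simps)
      qed
      then have "m\<^sup>2 \<le> integral {0..1} (\<lambda>x. (poly (r * p) x)\<^sup>2)"
        by (simp add: power2_eq_square)
      also have "\<dots> \<le> integral {0..1} (\<lambda>x. (\<bar>M\<bar> + 1) * (poly p x * poly p x))"
      proof (intro integral_le integrable_continuous_interval continuous_intros)
        fix x :: real assume "x \<in> {0..1}"
        then have "(poly r x)\<^sup>2 \<le> \<bar>M\<bar> + 1" using M[of x] by linarith
        then have "(poly r x)\<^sup>2 * (poly p x)\<^sup>2 \<le> (\<bar>M\<bar> + 1) * (poly p x)\<^sup>2"
          by (rule mult_right_mono) simp
        then show "(poly (r * p) x)\<^sup>2 \<le> (\<bar>M\<bar> + 1) * (poly p x * poly p x)"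
          by (simp add: power2_eq_square algebra_simps)
      qed
      also have "\<dots> = (\<bar>M\<bar> + 1) * L2ip (poly p) (poly p)" by (simp add: L2ip_def)
      finally show ?thesis by (simp add: m_def)
    qed
    then show ?thesis by (intro exI[of _ "\<bar>M\<bar> + 1"]) auto
  qed
  then obtain R where R: "\<And>j. R j > 0"
    "\<And>j p. degree p \<le> k \<Longrightarrow> (coeff p j)\<^sup>2 \<le> R j * L2ip (poly p) (poly p)"
    by metis
  have nonneg: "L2ip (poly p) (poly p) \<ge> 0" for p :: "real poly"
    unfolding L2ip_def by (intro integral_nonneg poly_mult_integrable) auto
  show ?thesis
  proof
    show "(\<Sum>j\<le>k. R j) > 0" using R(1) by (intro sum_pos) auto
    fix p :: "real poly" and j assume p: "degree p \<le> k"
    show "(coeff p j)\<^sup>2 \<le> (\<Sum>j\<le>k. R j) * L2ip (poly p) (poly p)"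
    proof (cases "j \<le> k")
      case True
      then have "R j \<le> (\<Sum>j\<le>k. R j)"
        using R(1) by (intro member_le_sum) (auto simp: less_imp_le)
      then show ?thesis using R(2)[OF p, of j] mult_right_mono[OF _ nonneg[of p]] by (meson order.trans)
    next
      case False
      then show ?thesis using p nonneg[of p] R(1)
        by (simp add: coeff_eq_0 sum_nonneg less_imp_le)
    qed
  qed
qed

text \<open>Stated on the reference cell, so that \<open>K\<close> depends on k alone and the lost
  power of h appears only on returning to the mesh. The coefficients control the derivative
  pointwise on the unit interval, at the price of the factors j + 1 from differentiation, collected
  in \<open>D\<close>.\<close>

lemma inverse_inequality:
  obtains K where "K > 0"
    "\<And>p. degree p \<le> k \<Longrightarrow> L2ip (poly (pderiv p)) (poly (pderiv p)) \<le> K * L2ip (poly p) (poly p)"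
proof -
  obtain R where R: "R > 0" "\<And>p j. degree p \<le> k \<Longrightarrow> (coeff p j)\<^sup>2 \<le> R * L2ip (poly p) (poly p)"
    using coeff_bound_L2[of k] by blast
  define D where "D = (\<Sum>j\<le>k. real (Suc j))"
  have D: "D > 0" unfolding D_def by (intro sum_pos) auto
  show ?thesis
  proof
    show "D\<^sup>2 * R > 0" using D R(1) by simp
    fix p :: "real poly" assume p: "degree p \<le> k"
    define I where "I = L2ip (poly p) (poly p)"
    have I: "I \<ge> 0" unfolding I_def L2ip_def by (intro integral_nonneg poly_mult_integrable) auto
    have "(poly (pderiv p) x)\<^sup>2 \<le> D\<^sup>2 * R * I" if x: "x \<in> {0..1}" for x
    proof -
      have c: "\<bar>coeff p j\<bar> \<le> sqrt (R * I)" for j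
        using real_sqrt_le_mono[OF R(2)[OF p, of j]] by (simp add: I_def)
      have "\<bar>poly (pderiv p) x\<bar> \<le> (\<Sum>j\<le>degree (pderiv p). \<bar>coeff (pderiv p) j * x ^ j\<bar>)"
        unfolding poly_altdef by (rule sum_abs)
      also have "\<dots> \<le> (\<Sum>j\<le>degree (pderiv p). real (Suc j) * sqrt (R * I))"
      proof (intro sum_mono)
        fix j
        have "\<bar>x ^ j\<bar> \<le> 1" using x by (simp add: power_abs power_le_one)
        then have "\<bar>coeff (pderiv p) j * x ^ j\<bar> \<le> \<bar>coeff (pderiv p) j\<bar>"
          by (simp add: abs_mult mult_left_le)
        also have "\<dots> = real (Suc j) * \<bar>coeff p (Suc j)\<bar>"
          by (simp add: coeff_pderiv abs_mult)
        also have "\<dots> \<le> real (Suc j) * sqrt (R * I)" by (intro mult_left_mono c) simp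
        finally show "\<bar>coeff (pderiv p) j * x ^ j\<bar> \<le> real (Suc j) * sqrt (R * I)" .
      qed
      also have "\<dots> \<le> (\<Sum>j\<le>k. real (Suc j) * sqrt (R * I))"
        using p degree_pderiv[of p] R(1) I by (intro sum_mono2) auto
      also have "\<dots> = D * sqrt (R * I)" by (simp add: D_def sum_distrib_right)
      finally have "\<bar>poly (pderiv p) x\<bar>\<^sup>2 \<le> (D * sqrt (R * I))\<^sup>2"
        by (intro power_mono) auto
      then show ?thesis using R(1) I by (simp add: power_mult_distrib mult.assoc)
    qed
    then have "integral {0..1} (\<lambda>x. poly (pderiv p) x * poly (pderiv p) x) \<le> integral {0..1} (\<lambda>x::real. D\<^sup>2 * R * I)"
      by (intro integral_le poly_mult_integrable) (auto simp: power2_eq_square)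
    then show "L2ip (poly (pderiv p)) (poly (pderiv p)) \<le> D\<^sup>2 * R * L2ip (poly p) (poly p)"
      by (simp add: L2ip_def I_def)
  qed
qed

text \<open>The shifted monic Legendre polynomial; for odd \<open>k\<close> its degree \<open>k + 1\<close> is even, so uniqueness
  makes it symmetric about \<open>1/2\<close>.\<close>

lemma orthogonal_polynomial:
  obtains L :: "real poly" where "degree L = k + 1" "coeff L (k + 1) = 1"
    "\<And>q. degree q \<le> k \<Longrightarrow> L2ip (poly L) (poly q) = 0"
    "odd k \<Longrightarrow> poly L 1 = poly L 0"
proof -
  define m where "m = (monom 1 (k + 1) :: real poly)"
  have "L2ip (poly m) (poly (p + smult a q)) = L2ip (poly m) (poly p) + a * L2ip (poly m) (poly q)"
    for p q a
    using L2ip_poly_linear[of p a q m] by (simp only: L2ip_commute[of "poly m"])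
  then obtain r where r: "degree r \<le> k"
    "\<And>p. degree p \<le> k \<Longrightarrow> L2ip (poly r) (poly p) = L2ip (poly m) (poly p)"
    using poly_riesz[of k "\<lambda>p. L2ip (poly m) (poly p)"] by blast
  define L where "L = m + smult (-1) r"
  have cL: "coeff L (k + 1) = 1" using r(1) by (simp add: L_def m_def coeff_eq_0)
  have "degree L \<le> k + 1" unfolding L_def m_def
    using r(1) by (intro degree_add_le degree_monom_le order.trans[OF degree_smult_le]) auto
  then have dL: "degree L = k + 1" using cL le_degree[of L "k + 1"] by simp
  have orth: "L2ip (poly L) (poly q) = 0" if "degree q \<le> k" for q
    unfolding L_def L2ip_poly_linear using r(2)[OF that] by simp
  have "poly L 1 = poly L 0" if k: "odd k"
  proof -
    define L' where "L' = pcompose L [:1, -1:]"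
    have "lead_coeff L' = (-1) ^ (k + 1)"
      unfolding L'_def using dL cL by (subst lead_coeff_comp) auto
    moreover have dL': "degree L' = k + 1" unfolding L'_def by (simp add: degree_pcompose dL)
    ultimately have cL': "coeff L' (k + 1) = 1" using k by simp
    have orth': "L2ip (poly L') (poly q) = 0" if q: "degree q \<le> k" for q
    proof -
      let ?q = "pcompose q [:1, -1:]"
      have "degree ?q \<le> k" using q by (simp add: degree_pcompose)
      from orth[OF this] have "((\<lambda>x. poly L x * poly ?q x) has_integral 0) (cbox 0 1)"
        using integrable_integral[OF poly_mult_integrable[of L ?q]] by (simp add: L2ip_def)
      from has_integral_affinity[OF this, of "-1" 1]
      have "((\<lambda>x. poly L' x * poly q x) has_integral 0) ((\<lambda>x. 1 - x) ` {0..1})"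
        by (simp add: L'_def poly_pcompose)
      moreover have "(\<lambda>x. 1 - x) ` {0..1} = {0..1::real}"
        by (auto simp: image_iff intro: bexI[of _ "1 - _"])
      ultimately show ?thesis by (simp add: L2ip_def integral_unique)
    qed
    \<comment> \<open>Reflection keeps the leading coefficient because the degree is even, so it
      cancels in \<open>d\<close>. Thus \<open>d\<close> has degree at most k and is one of the
      polynomials to which both \<open>L\<close> and \<open>L'\<close> are orthogonal; in particular
      it is orthogonal to itself.\<close>
    define d where "d = L' + smult (-1) L"
    have "degree d \<le> k"
    proof (rule degree_le, intro allI impI)
      fix i assume "k < i"
      then show "coeff d i = 0"
        using cL cL' dL dL' by (cases "i = k + 1") (auto simp: d_def coeff_eq_0)
    qed
    then have "L2ip (poly d) (poly d) = 0"
      using L2ip_poly_linear[of L' "-1" L d, folded d_def] orth orth' by simp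
    then have "d = 0" by (rule poly_L2ip_self_eq_zero)
    then have "poly L' 0 = poly L 0" by (simp add: d_def)
    then show ?thesis by (simp add: L'_def poly_pcompose)
  qed
  then show ?thesis using that[OF dL cL orth] by blast
qed

subsection \<open>Smooth periodic functions\<close>

lemma Cpm_deriv_in_Cp: "u \<in> Cpm m \<Longrightarrow> j \<le> m \<Longrightarrow> (deriv ^^ j) u \<in> Cp"
  by (simp add: Cpm_def)

lemma Cpm_mono: "u \<in> Cpm m \<Longrightarrow> n \<le> m \<Longrightarrow> u \<in> Cpm n"
  by (auto simp: Cpm_def)

lemma Cpm_has_derivative:
  assumes "u \<in> Cpm m" "j < m"
  shows "((deriv ^^ j) u has_real_derivative (deriv ^^ Suc j) u x) (at x)"
  using assms by (auto simp: Cpm_def DERIV_deriv_iff_real_differentiable)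

lemma Cpm_funpow_deriv:
  assumes "u \<in> Cpm (i + m)"
  shows "(deriv ^^ i) u \<in> Cpm m"
proof -
  have "(deriv ^^ j) ((deriv ^^ i) u) = (deriv ^^ (i + j)) u" for j
    by (simp add: funpow_add add.commute[of i])
  then show ?thesis using assms by (simp add: Cpm_def)
qed

text \<open>\<open>supnorm\<close> is a supremum in a conditionally complete order, so boundedness
  has to come first; compactness of one period gives it.\<close>

lemma abs_le_supnorm:
  assumes "f \<in> Cp"
  shows "\<bar>f x\<bar> \<le> supnorm f"
proof -
  have "compact (f ` {0..1})"
    by (intro compact_continuous_image Cp_continuous_on assms) auto
  then obtain M where M: "\<And>y. y \<in> {0..1} \<Longrightarrow> \<bar>f y\<bar> \<le> M"
    by (force dest!: compact_imp_bounded simp: bounded_iff)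
  have "\<bar>f y\<bar> \<le> M" for y
  proof -
    have "f (frac y + of_int \<lfloor>y\<rfloor>) = f (frac y)" by (rule Cp_shift_int[OF assms])
    moreover have "frac y \<in> {0..1}" using frac_lt_1[of y] by simp
    ultimately show ?thesis using M[of "frac y"] by (simp add: frac_def)
  qed
  then have "bdd_above (range (\<lambda>x. \<bar>f x\<bar>))" by (auto intro!: bdd_aboveI[of _ M])
  then show ?thesis unfolding supnorm_def by (rule cSUP_upper[rotated]) simp
qed

lemma supnorm_nonneg: "f \<in> Cp \<Longrightarrow> supnorm f \<ge> 0"
  using abs_le_supnorm[of f 0] by linarith

lemma Cpm_taylor:
  assumes "u \<in> Cpm m"
  shows "\<bar>u (x + t) - (\<Sum>j<m. (deriv ^^ j) u x / fact j * t ^ j)\<bar>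
    \<le> supnorm ((deriv ^^ m) u) * \<bar>t\<bar> ^ m"
proof -
  define D where "D j t = (deriv ^^ j) u (x + t)" for j t
  have "\<forall>j s. j < m \<and> \<bar>s\<bar> \<le> \<bar>t\<bar> \<longrightarrow> (D j has_real_derivative D (Suc j) s) (at s)"
    unfolding D_def add.commute[of x] DERIV_shift[symmetric] using Cpm_has_derivative[OF assms] by blast
  moreover have "D 0 = (\<lambda>t. u (x + t))" by (simp add: D_def[abs_def])
  ultimately obtain s where s: "u (x + t) = (\<Sum>j<m. D j 0 / fact j * t ^ j) + D m s / fact m * t ^ m"
    using Maclaurin_bi_le[of D "\<lambda>t. u (x + t)" m t] by blast
  have "\<bar>D m s / fact m * t ^ m\<bar> = \<bar>D m s\<bar> / fact m * \<bar>t\<bar> ^ m"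
    by (simp add: abs_mult power_abs)
  also have "\<dots> \<le> supnorm ((deriv ^^ m) u) * \<bar>t\<bar> ^ m"
  proof (rule mult_right_mono)
    have "\<bar>D m s\<bar> / fact m \<le> \<bar>D m s\<bar>"
      using divide_left_mono[of 1 "fact m" "\<bar>D m s\<bar>"] by (simp add: fact_ge_1)
    also have "\<dots> \<le> supnorm ((deriv ^^ m) u)"
      unfolding D_def by (intro abs_le_supnorm Cpm_deriv_in_Cp[OF assms]) simp
    finally show "\<bar>D m s\<bar> / fact m \<le> supnorm ((deriv ^^ m) u)" .
  qed simp
  finally show ?thesis unfolding s by (simp add: D_def)
qed

lemma Cpm_lipschitz:
  assumes "u \<in> Cpm (Suc j)"
  shows "\<bar>(deriv ^^ j) u (x + t) - (deriv ^^ j) u x\<bar> \<le> supnorm ((deriv ^^ Suc j) u) * \<bar>t\<bar>"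
  using Cpm_taylor[OF Cpm_funpow_deriv[of u j 1], of x t] assms by simp

subsection \<open>Weak form of the projected derivative\<close>

text \<open>Integration by parts cell by cell, as w - u need not be differentiable at the nodes; the
  boundary terms telescope and vanish by periodicity. The derivative on the right is taken in the
  local coordinate: the factor N from the chain rule cancels the cell length 1/N, and no power of h
  remains.\<close>

lemma proj_err_deriv_weak:
  fixes Q :: "nat \<Rightarrow> real poly"
  assumes N: "N \<ge> 1" and u: "u \<in> Cpm 1" and w: "w \<in> Vh N k" and \<psi>: "\<psi> \<in> Cp"
    and Q: "\<And>i s. i < N \<Longrightarrow> s \<in> {0..1} \<Longrightarrow> \<psi> ((real i + s) / real N) = poly (Q i) s"
  shows "((\<lambda>x. deriv (\<lambda>y. w y - u y) x * \<psi> x) has_integral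
     - (\<Sum>i<N. integral {0..1} (\<lambda>s. (w ((real i + s) / real N) - u ((real i + s) / real N))
          * poly (pderiv (Q i)) s))) {0..1}"
proof -
  define e where "e y = w y - u y" for y
  define J where "J i = integral {0..1} (\<lambda>s. e ((real i + s) / real N) * poly (pderiv (Q i)) s)" for i
  define b where "b i = e (real i / real N) * \<psi> (real i / real N)" for i
  have uCp: "u \<in> Cp" using Cpm_deriv_in_Cp[OF u, of 0] by simp
  have eCp: "e \<in> Cp" using Cp_linear_combination[OF Vh_Cp[OF w] uCp, of "-1"] by (simp add: e_def[abs_def])
  have cell: "((\<lambda>s. deriv e ((real i + s) / real N) * \<psi> ((real i + s) / real N)) has_integral
      real N * (b (Suc i) - b i - J i)) {0..1}" if i: "i < N" for i
  proof -
    obtain P where P: "\<And>s. s \<in> {0..1} \<Longrightarrow> w ((real i + s) / real N) = poly P s"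
      using Vh_cell[OF w N, of "int i"] by auto
    define D where "D s = poly P s - u ((real i + s) / real N)" for s
    define D' where "D' s = poly (pderiv P) s - deriv u ((real i + s) / real N) / real N" for s
    have eD: "e ((real i + s) / real N) = D s" if "s \<in> {0..1}" for s
      using P[OF that] by (simp add: e_def D_def)
    have DD: "(D has_real_derivative D' s) (at s)" for s
    proof -
      have "(u has_real_derivative deriv u ((real i + s) / real N)) (at ((real i + s) / real N))"
        using Cpm_has_derivative[OF u, of 0] by simp
      moreover have "((\<lambda>s. (real i + s) / real N) has_real_derivative 1 / real N) (at s)"
        using N by (auto intro!: derivative_eq_intros)
      ultimately have "((\<lambda>s. u ((real i + s) / real N)) has_real_derivative
          deriv u ((real i + s) / real N) * (1 / real N)) (at s)"
        by (rule DERIV_chain2)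
      then show ?thesis unfolding D_def D'_def by (intro DERIV_diff poly_DERIV) simp
    qed
    have deriv_e: "deriv e ((real i + s) / real N) = real N * D' s" if s: "s \<in> {0<..<1}" for s
    proof (rule DERIV_imp_deriv)
      let ?y = "(real i + s) / real N" and ?S = "{real i / real N<..<real (Suc i) / real N}"
      have NyE: "real N * ?y - real i = s" using N by simp
      have "((\<lambda>y. D (real N * y - real i)) has_real_derivative D' (real N * ?y - real i) * real N) (at ?y)"
        by (rule DERIV_chain2[OF DD]) (auto intro!: derivative_eq_intros)
      then have "((\<lambda>y. D (real N * y - real i)) has_real_derivative real N * D' s) (at ?y)"
        unfolding NyE by (simp only: mult.commute)
      then show "(e has_real_derivative real N * D' s) (at ?y)"
      proof (rule has_field_derivative_transform_within_open)
        show "?y \<in> ?S" using s N by (simp add: divide_strict_right_mono)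
        fix y assume y: "y \<in> ?S"
        then have "real N * y - real i \<in> {0..1}"
          using N by (simp add: pos_divide_less_eq pos_less_divide_eq mult.commute)
        from eD[OF this] show "D (real N * y - real i) = e y" using N by simp
      qed simp
    qed
    have cD: "continuous_on S D" for S
      using DERIV_continuous_on[of S D D'] DD by (meson has_field_derivative_at_within)
    have "((\<lambda>s. D' s * poly (Q i) s + D s * poly (pderiv (Q i)) s) has_integral
        (D 1 * poly (Q i) 1 - D 0 * poly (Q i) 0)) {0..1}"
    proof (rule fundamental_theorem_of_calculus)
      fix x :: real
      have "((\<lambda>s. D s * poly (Q i) s) has_real_derivative
          D' x * poly (Q i) x + D x * poly (pderiv (Q i)) x) (at x)"
        using DERIV_mult'[OF DD poly_DERIV] by (simp add: algebra_simps)
      then show "((\<lambda>s. D s * poly (Q i) s) has_vector_derivative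
          D' x * poly (Q i) x + D x * poly (pderiv (Q i)) x) (at x within {0..1})"
        unfolding has_real_derivative_iff_has_vector_derivative
        by (rule has_vector_derivative_at_within)
    qed simp
    moreover have "D 1 * poly (Q i) 1 - D 0 * poly (Q i) 0 = b (Suc i) - b i"
      using Q[OF i, of 1] Q[OF i, of 0] eD[of 1] eD[of 0] by (simp add: b_def add.commute)
    moreover have "((\<lambda>s. D s * poly (pderiv (Q i)) s) has_integral J i) {0..1}"
    proof -
      have "J i = integral {0..1} (\<lambda>s. D s * poly (pderiv (Q i)) s)"
        unfolding J_def by (intro integral_cong) (simp only: eD)
      then show ?thesis
        by (simp only:) (intro integrable_integral continuous_mult_integrable cD continuous_intros)
    qed
    ultimately have "((\<lambda>s. D' s * poly (Q i) s + D s * poly (pderiv (Q i)) s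
        - D s * poly (pderiv (Q i)) s) has_integral (b (Suc i) - b i - J i)) {0..1}"
      using has_integral_diff by metis
    then have "((\<lambda>s. real N * (D' s * poly (Q i) s)) has_integral real N * (b (Suc i) - b i - J i)) (cbox 0 1)"
      using has_integral_mult_right[of "\<lambda>s. D' s * poly (Q i) s"] by simp
    \<comment> \<open>The formula for \<open>deriv e\<close> holds inside the cell only; whatever
      value \<open>deriv\<close> has at the two nodes does not affect the integral.\<close>
    then have "((\<lambda>s. deriv e ((real i + s) / real N) * \<psi> ((real i + s) / real N)) has_integral
        real N * (b (Suc i) - b i - J i)) (cbox 0 1)"
      by (rule has_integral_spike_interior) (use Q[OF i] in \<open>simp add: deriv_e\<close>)
    then show ?thesis by simp
  qed
  have "((\<lambda>x. deriv e x * \<psi> x) has_integral (\<Sum>i<N. real N * (b (Suc i) - b i - J i)) / real N) {0..1}"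
    by (rule has_integral_cells[OF N]) (rule cell)
  moreover have "(\<Sum>i<N. real N * (b (Suc i) - b i - J i)) / real N = - (\<Sum>i<N. J i)"
  proof -
    have "(\<Sum>i<N. b (Suc i) - b i) = b N - b 0" by (rule sum_lessThan_telescope)
    also have "\<dots> = 0"
      using N Cp_shift_int[OF eCp, of 0 1] Cp_shift_int[OF \<psi>, of 0 1] by (simp add: b_def)
    finally have "(\<Sum>i<N. b (Suc i) - b i - J i) = - (\<Sum>i<N. J i)"
      by (simp add: sum_subtractf)
    then show ?thesis using N by (simp flip: sum_distrib_left)
  qed
  ultimately show ?thesis by (simp add: J_def e_def[abs_def])
qed

lemma L2proj_continuous:
  assumes "N \<ge> 1" "k \<ge> 1" "u \<in> Cp"
  shows "L2proj N k u \<in> Vh N k"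
    and "\<psi> \<in> Vh N k \<Longrightarrow> L2ip (\<lambda>x. L2proj N k u x - u x) \<psi> = 0"
proof -
  have int: "(\<lambda>x. u x * \<psi> x) integrable_on {0..1}" if "\<psi> \<in> Vh N k" for \<psi>
    by (intro continuous_mult_integrable Cp_continuous_on assms(3) Vh_Cp[OF that])
  show V: "L2proj N k u \<in> Vh N k" by (rule L2proj_in_Vh[OF assms(1,2) int])
  assume \<psi>: "\<psi> \<in> Vh N k"
  have "(\<lambda>x. L2proj N k u x * \<psi> x) integrable_on {0..1}"
    using V \<psi> by (intro continuous_mult_integrable Cp_continuous_on Vh_Cp)
  from L2ip_linear[OF this int[OF \<psi>], of "-1"] show "L2ip (\<lambda>x. L2proj N k u x - u x) \<psi> = 0"
    using L2ip_L2proj[OF assms(1,2) int \<psi>] by simp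
qed

text \<open>The weak form settles two matters at once: the derivative is integrable against every
  test function, so the projection lemma applies to it, and the inner products acquire the stated
  value.\<close>

lemma L2proj_proj_err_deriv:
  fixes Q :: "nat \<Rightarrow> real poly"
  assumes N: "N \<ge> 1" and k: "k \<ge> 1" and u: "u \<in> Cpm 1"
  shows L2proj_proj_err_deriv_in_Vh: "L2proj N k (proj_err_deriv N k u) \<in> Vh N k"
    and L2ip_L2proj_proj_err_deriv:
      "\<psi> \<in> Vh N k \<Longrightarrow>
       (\<And>i s. i < N \<Longrightarrow> s \<in> {0..1} \<Longrightarrow> \<psi> ((real i + s) / real N) = poly (Q i) s) \<Longrightarrow>
       L2ip (L2proj N k (proj_err_deriv N k u)) \<psi> =
        - (\<Sum>i<N. integral {0..1} (\<lambda>s.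
            (L2proj N k u ((real i + s) / real N) - u ((real i + s) / real N)) * poly (pderiv (Q i)) s))"
proof -
  have uCp: "u \<in> Cp" using Cpm_deriv_in_Cp[OF u, of 0] by simp
  note w = L2proj_continuous(1)[OF N k uCp]
  have int: "(\<lambda>x. proj_err_deriv N k u x * \<psi> x) integrable_on {0..1}" if \<psi>: "\<psi> \<in> Vh N k" for \<psi>
  proof -
    have "\<exists>q. \<forall>s\<in>{0..1}. \<psi> ((real i + s) / real N) = poly q s" for i
      using Vh_cell[OF \<psi> N, of "int i"] by (metis of_int_of_nat_eq)
    then obtain q where "\<And>i s. s \<in> {0..1} \<Longrightarrow> \<psi> ((real i + s) / real N) = poly (q i) s"
      by metis
    then show ?thesis unfolding proj_err_deriv_def
      using proj_err_deriv_weak[OF N u w Vh_Cp[OF \<psi>]] by blast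
  qed
  show "L2proj N k (proj_err_deriv N k u) \<in> Vh N k" by (rule L2proj_in_Vh[OF N k int])
  assume \<psi>: "\<psi> \<in> Vh N k"
    and Q: "\<And>i s. i < N \<Longrightarrow> s \<in> {0..1} \<Longrightarrow> \<psi> ((real i + s) / real N) = poly (Q i) s"
  have "L2ip (L2proj N k (proj_err_deriv N k u)) \<psi> = L2ip (proj_err_deriv N k u) \<psi>"
    by (rule L2ip_L2proj[OF N k int \<psi>])
  also have "\<dots> = - (\<Sum>i<N. integral {0..1} (\<lambda>s.
            (L2proj N k u ((real i + s) / real N) - u ((real i + s) / real N)) * poly (pderiv (Q i)) s))"
    unfolding L2ip_def proj_err_deriv_def
    by (rule integral_unique[OF proj_err_deriv_weak[OF N u w Vh_Cp[OF \<psi>] Q]])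
  finally show "L2ip (L2proj N k (proj_err_deriv N k u)) \<psi> = - (\<Sum>i<N. integral {0..1} (\<lambda>s.
            (L2proj N k u ((real i + s) / real N) - u ((real i + s) / real N)) * poly (pderiv (Q i)) s))" .
qed

subsection \<open>Odd degree\<close>

lemma L2norm_eq_L2ip: "L2norm f = sqrt (L2ip f f)"
  by (simp add: L2norm_def L2ip_def power2_eq_square)

lemma unit_interval_integral_add_mult:
  fixes f g :: "real \<Rightarrow> real"
  assumes "continuous_on {0..1} f" "continuous_on {0..1} g"
  shows "integral {0..1} (\<lambda>x. f x + a * g x) = integral {0..1} f + a * integral {0..1} g"
  using assms by (subst integral_add) (auto intro!: integrable_continuous_interval continuous_intros)

text \<open>If \<open>u\<close> differs from a finite element function \<open>v\<close> by cellwise multiples of a polynomial \<open>L\<close>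
  orthogonal to all polynomials of degree at most \<open>k\<close>, then so does \<open>Pu\<close>, by best approximation, and
  these multiples of \<open>L\<close> are invisible to derivatives of test functions.\<close>

lemma L2norm_L2proj_proj_err_deriv_le:
  fixes c :: "nat \<Rightarrow> real"
  assumes N: "N \<ge> 1" and k: "k \<ge> 1" and u: "u \<in> Cpm 1" and v: "v \<in> Vh N k"
    and K: "K > 0"
      "\<And>p. degree p \<le> k \<Longrightarrow> L2ip (poly (pderiv p)) (poly (pderiv p)) \<le> K * L2ip (poly p) (poly p)"
    and L: "\<And>q. degree q \<le> k \<Longrightarrow> L2ip (poly L) (poly q) = 0"
    and B: "B \<ge> 0"
      "\<And>i s. i < N \<Longrightarrow> s \<in> {0..1} \<Longrightarrow>
        \<bar>v ((real i + s) / real N) - u ((real i + s) / real N) - c i * poly L s\<bar> \<le> B"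
  shows "L2norm (L2proj N k (proj_err_deriv N k u)) \<le> sqrt K * real N * B"
proof -
  define w where "w = L2proj N k u"
  define F where "F = L2proj N k (proj_err_deriv N k u)"
  have uCp: "u \<in> Cp" using Cpm_deriv_in_Cp[OF u, of 0] by simp
  have w: "w \<in> Vh N k" "\<And>\<psi>. \<psi> \<in> Vh N k \<Longrightarrow> L2ip (\<lambda>x. w x - u x) \<psi> = 0"
    unfolding w_def using L2proj_continuous[OF N k uCp] by auto
  have F: "F \<in> Vh N k" unfolding F_def by (rule L2proj_proj_err_deriv_in_Vh[OF N k u])
  define ref where "ref f i s = f ((real i + s) / real N)" for f :: "real \<Rightarrow> real" and i s
  have ref_cont: "continuous_on {0..1} (ref f i)" if "f \<in> Cp" for f i
    unfolding ref_def
    by (rule continuous_on_compose2[OF Cp_continuous_on[OF that, of UNIV]]) (use N in \<open>auto intro!: continuous_intros\<close>)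
  have cells: "\<exists>P. \<forall>i. degree (P i) \<le> k \<and> (\<forall>s\<in>{0..1}. ref f i s = poly (P i) s)" if f: "f \<in> Vh N k" for f
  proof -
    have "\<exists>p. degree p \<le> k \<and> (\<forall>s\<in>{0..1}. ref f i s = poly p s)" for i
      unfolding ref_def using Vh_cell[OF f N, of "int i"] by (metis of_int_of_nat_eq)
    then show ?thesis by metis
  qed
  obtain Q where Q: "\<And>i. degree (Q i) \<le> k" "\<And>i s. s \<in> {0..1} \<Longrightarrow> ref F i s = poly (Q i) s"
    using cells[OF F] by blast
  define z where "z = (\<lambda>x. w x + (-1) * v x)"
  have z: "z \<in> Vh N k" unfolding z_def by (rule Vh_linear_combination[OF w(1) v])
  obtain Z where Z: "\<And>i. degree (Z i) \<le> k" "\<And>i s. s \<in> {0..1} \<Longrightarrow> ref z i s = poly (Z i) s"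
    using cells[OF z] by blast
  define e where "e = (\<lambda>x. w x + (-1) * u x)"
  have e: "e \<in> Cp" unfolding e_def by (rule Cp_linear_combination[OF Vh_Cp[OF w(1)] uCp])
  define E where "E i s = ref e i s - c i * poly L s" for i s
  have cE: "continuous_on {0..1} (E i)" for i
    unfolding E_def by (intro continuous_intros ref_cont e)
  define A where "A i = integral {0..1} (\<lambda>s. E i s * E i s)" for i

  have LQ: "integral {0..1} (\<lambda>s. poly L s * poly q s) = 0" if "degree q \<le> k" for q
    using L[OF that] by (simp add: L2ip_def)
  have Eq: "integral {0..1} (\<lambda>s. E i s * poly q s) = integral {0..1} (\<lambda>s. ref e i s * poly q s)"
    if "degree q \<le> k" for i q
  proof -
    have "integral {0..1} (\<lambda>s. ref e i s * poly q s + (- c i) * (poly L s * poly q s))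
        = integral {0..1} (\<lambda>s. ref e i s * poly q s) + (- c i) * integral {0..1} (\<lambda>s. poly L s * poly q s)"
      by (intro unit_interval_integral_add_mult continuous_intros ref_cont e)
    then show ?thesis by (simp add: LQ[OF that] E_def algebra_simps)
  qed

  have EZ: "(\<Sum>i<N. integral {0..1} (\<lambda>s. E i s * poly (Z i) s)) = 0"
  proof -
    have "L2ip e z = (\<Sum>i<N. integral {0..1} (\<lambda>s. ref e i s * poly (Z i) s)) / real N"
    proof (rule L2ip_cells[OF N])
      fix i assume "i < N"
      have "((\<lambda>s. ref e i s * poly (Z i) s) has_integral integral {0..1} (\<lambda>s. ref e i s * poly (Z i) s)) {0..1}"
        by (intro integrable_integral continuous_mult_integrable ref_cont e continuous_intros)
      then show "((\<lambda>s. e ((real i + s) / real N) * z ((real i + s) / real N)) has_integral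
          integral {0..1} (\<lambda>s. ref e i s * poly (Z i) s)) {0..1}"
        by (rule has_integral_eq[rotated]) (simp add: Z(2)[symmetric] ref_def)
    qed
    moreover have "L2ip e z = 0" using w(2)[OF z] by (simp add: e_def)
    ultimately show ?thesis using N by (simp add: Eq[OF Z(1)])
  qed
  \<comment> \<open>With \<open>E = Z + r\<close> one has E^2 = r^2 + 2 E Z - Z^2. The mixed term is
    kept here because only its sum over the cells vanishes: \<open>EZ\<close> is the orthogonality
    of Pu - u to the element \<open>z\<close>, and the multiples of \<open>L\<close> do not change
    it.\<close>
  have A_le: "A i \<le> B\<^sup>2 + 2 * integral {0..1} (\<lambda>s. E i s * poly (Z i) s)" if i: "i < N" for i
  proof -
    have "A i \<le> integral {0..1} (\<lambda>s. B\<^sup>2 + 2 * (E i s * poly (Z i) s))"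
      unfolding A_def
    proof (intro integral_le integrable_continuous_interval continuous_intros cE)
      fix s :: real assume s: "s \<in> {0..1}"
      define r where "r = v ((real i + s) / real N) - u ((real i + s) / real N) - c i * poly L s"
      have "E i s = poly (Z i) s + r"
        using Z(2)[OF s, of i] by (simp add: E_def e_def z_def ref_def r_def)
      then have "E i s * E i s = r\<^sup>2 + 2 * (E i s * poly (Z i) s) - (poly (Z i) s)\<^sup>2"
        by (simp add: power2_eq_square algebra_simps)
      also have "r\<^sup>2 \<le> B\<^sup>2" using B(2)[OF i s] B(1) by (simp add: r_def flip: abs_le_square_iff)
      finally show "E i s * E i s \<le> B\<^sup>2 + 2 * (E i s * poly (Z i) s)"
        using zero_le_power2[of "poly (Z i) s"] by linarith
    qed
    also have "\<dots> = integral {0..1} (\<lambda>s::real. B\<^sup>2) + 2 * integral {0..1} (\<lambda>s. E i s * poly (Z i) s)"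
      by (intro unit_interval_integral_add_mult continuous_intros cE)
    finally show ?thesis by simp
  qed
  have A_sum: "(\<Sum>i<N. A i) \<le> real N * B\<^sup>2"
  proof -
    have "(\<Sum>i<N. A i) \<le> (\<Sum>i<N. B\<^sup>2 + 2 * integral {0..1} (\<lambda>s. E i s * poly (Z i) s))"
      by (intro sum_mono) (simp add: A_le)
    also have "\<dots> = real N * B\<^sup>2 + 2 * (\<Sum>i<N. integral {0..1} (\<lambda>s. E i s * poly (Z i) s))"
      by (simp add: sum.distrib sum_distrib_left)
    finally show ?thesis by (simp add: EZ)
  qed

  have FF: "L2ip F F = (\<Sum>i<N. L2ip (poly (Q i)) (poly (Q i))) / real N"
  proof (rule L2ip_cells[OF N])
    fix i assume "i < N"
    have "((\<lambda>s. poly (Q i) s * poly (Q i) s) has_integral L2ip (poly (Q i)) (poly (Q i))) {0..1}"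
      unfolding L2ip_def by (intro integrable_integral poly_mult_integrable)
    then show "((\<lambda>s. F ((real i + s) / real N) * F ((real i + s) / real N)) has_integral
        L2ip (poly (Q i)) (poly (Q i))) {0..1}"
      by (rule has_integral_eq[rotated]) (simp add: Q(2)[symmetric] ref_def)
  qed
  \<comment> \<open>Testing with \<open>F\<close> itself and applying Young's inequality with weight
    \<open>t\<close> on each cell produces \<open>K / (2 * t) * real N * L2ip F F\<close>. This
    choice of \<open>t\<close> makes the factor exactly 1/2, so the term is absorbed on the
    left.\<close>
  define t where "t = K * real N"
  have t: "t > 0" using K(1) N by (simp add: t_def)
  have "L2ip F F = - (\<Sum>i<N. integral {0..1} (\<lambda>s. ref e i s * poly (pderiv (Q i)) s))"
    unfolding F_def
    by (subst L2ip_L2proj_proj_err_deriv[OF N k u, of _ Q])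
      (use F Q(2) in \<open>auto simp: F_def ref_def e_def w_def\<close>)
  also have "\<dots> = - (\<Sum>i<N. integral {0..1} (\<lambda>s. E i s * poly (pderiv (Q i)) s))"
    using Q(1) by (subst Eq) (auto simp: degree_pderiv intro: order.trans[OF diff_le_self])
  also have "\<dots> \<le> (\<Sum>i<N. t / 2 * A i + K / (2 * t) * L2ip (poly (Q i)) (poly (Q i)))"
    unfolding sum_negf[symmetric]
  proof (intro sum_mono)
    fix i assume "i \<in> {..<N}"
    have "- integral {0..1} (\<lambda>s. E i s * poly (pderiv (Q i)) s)
        = integral {0..1} (\<lambda>s. - (E i s * poly (pderiv (Q i)) s))" by simp
    also have "\<dots> \<le> integral {0..1} (\<lambda>s. t / 2 * (E i s * E i s)
        + 1 / (2 * t) * (poly (pderiv (Q i)) s * poly (pderiv (Q i)) s))"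
    proof (intro integral_le integrable_continuous_interval continuous_intros cE)
      fix s :: real
      let ?a = "E i s" and ?b = "poly (pderiv (Q i)) s"
      have "0 \<le> (t * ?a + ?b)\<^sup>2 / (2 * t)" using t by simp
      also have "\<dots> = t / 2 * (?a * ?a) + 1 / (2 * t) * (?b * ?b) + ?a * ?b"
        using t by (simp add: power2_eq_square field_simps)
      finally show "- (?a * ?b) \<le> t / 2 * (?a * ?a) + 1 / (2 * t) * (?b * ?b)" by linarith
    qed
    also have "\<dots> = t / 2 * A i + 1 / (2 * t) * L2ip (poly (pderiv (Q i))) (poly (pderiv (Q i)))"
      unfolding A_def L2ip_def
      by (subst unit_interval_integral_add_mult) (auto intro!: continuous_intros cE)
    also have "1 / (2 * t) * L2ip (poly (pderiv (Q i))) (poly (pderiv (Q i)))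
        \<le> 1 / (2 * t) * (K * L2ip (poly (Q i)) (poly (Q i)))"
      using t K(2)[OF Q(1)] by (intro mult_left_mono) auto
    finally show "- integral {0..1} (\<lambda>s. E i s * poly (pderiv (Q i)) s)
        \<le> t / 2 * A i + K / (2 * t) * L2ip (poly (Q i)) (poly (Q i))" by simp
  qed
  also have "\<dots> = t / 2 * (\<Sum>i<N. A i) + K / (2 * t) * (\<Sum>i<N. L2ip (poly (Q i)) (poly (Q i)))"
    by (simp add: sum.distrib sum_distrib_left)
  also have "\<dots> \<le> t / 2 * (real N * B\<^sup>2) + K / (2 * t) * (real N * L2ip F F)"
    using A_sum t N K(1) by (intro add_mono mult_left_mono) (auto simp: FF)
  also have "\<dots> = K * (real N)\<^sup>2 * B\<^sup>2 / 2 + L2ip F F / 2"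
    using K(1) N by (simp add: t_def power2_eq_square)
  finally have "L2ip F F \<le> (sqrt K * real N * B)\<^sup>2"
    using K(1) by (simp add: power_mult_distrib)
  then have "sqrt (L2ip F F) \<le> sqrt K * real N * B"
    using K(1) B(1) by (intro real_le_lsqrt) auto
  then show ?thesis by (simp add: L2norm_eq_L2ip F_def)
qed

text \<open>On each cell the Taylor polynomial of degree k + 1 at the left node, written in the
  local coordinate, loses its top term to a multiple of the monic \<open>L\<close>, which brings it
  into degree k. A linear correction then restores continuity. The constant counts 1 for Taylor's
  remainder and 1 + |L(0)| for the correction.\<close>

lemma quasi_interpolant:
  fixes L :: "real poly"
  assumes N: "N \<ge> 1" and k: "k \<ge> 1" and u: "u \<in> Cpm (k + 2)"
    and L: "degree L = k + 1" "coeff L (k + 1) = 1" "poly L 1 = poly L 0"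
  obtains v c where "v \<in> Vh N k"
    "\<And>(i::nat) s. s \<in> {0..1} \<Longrightarrow> \<bar>v ((real i + s) / real N) - u ((real i + s) / real N) - c i * poly L s\<bar>
      \<le> (2 + \<bar>poly L 0\<bar>) * (1 / real N) ^ (k + 2) * supnorm ((deriv ^^ (k + 2)) u)"
proof -
  define h where "h = 1 / real N"
  have h: "h > 0" using N by (simp add: h_def)
  define M where "M = supnorm ((deriv ^^ (k + 2)) u)"
  have M: "M \<ge> 0" unfolding M_def by (intro supnorm_nonneg Cpm_deriv_in_Cp[OF u]) simp
  define a where "a j i = h ^ j * (deriv ^^ j) u (of_int i / real N) / fact j" for j and i :: int
  define c where "c i = - a (k + 1) i" for i
  define T where "T i = (\<Sum>j<k + 2. monom (a j i) j)" for i
  define p0 where "p0 i = T i + smult (c i) L" for i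
  \<comment> \<open>The correction \<open>J i * s\<close> vanishes at the left end of its cell, so
    repairing the right end of one cell leaves the match with the preceding cell intact.\<close>
  define J where "J i = poly (p0 (i + 1)) 0 - poly (p0 i) 1" for i
  define p where "p i = p0 i + monom (J i) 1" for i
  have per: "a j (i + int N) = a j i" if "j \<le> k + 2" for i j
    using Cp_shift_cells[OF Cpm_deriv_in_Cp[OF u that] N, of i 1 0] by (simp add: a_def)
  have perT: "T (i + int N) = T i" for i
    unfolding T_def by (intro sum.cong) (auto simp: per)
  have perp0: "p0 (i + int N) = p0 i" for i
    unfolding p0_def c_def by (simp add: perT per)
  have perp: "p (i + int N) = p i" for i
    using perp0[of i] perp0[of "i + 1"] by (simp add: p_def J_def add.commute add.left_commute)
  have coeffT: "coeff (T i) n = (if n < k + 2 then a n i else 0)" for i n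
    unfolding T_def by (simp add: coeff_sum)
  have "degree (p0 i) \<le> k" for i
  proof (rule degree_le, intro allI impI)
    fix n assume "k < n"
    then show "coeff (p0 i) n = 0"
      using L by (cases "n = k + 1") (auto simp: p0_def c_def coeffT coeff_eq_0)
  qed
  then have degp: "degree (p i) \<le> k" for i
    unfolding p_def using k by (intro degree_add_le order.trans[OF degree_monom_le]) auto
  have match: "poly (p i) 1 = poly (p (i + 1)) 0" for i
    by (simp add: p_def J_def poly_monom)
  obtain v where v: "v \<in> Vh N k"
    "\<And>i s. s \<in> {0..1} \<Longrightarrow> v ((of_int i + s) / real N) = poly (p i) s"
    using Vh_glue[of N p k] N degp perp match by blast
  have T_err: "\<bar>poly (T i) s - u ((of_int i + s) / real N)\<bar> \<le> M * h ^ (k + 2)"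
    if s: "s \<in> {0..1}" for i s
  proof -
    have "poly (T i) s = (\<Sum>j<k + 2. (deriv ^^ j) u (of_int i / real N) / fact j * (h * s) ^ j)"
      unfolding T_def poly_sum by (intro sum.cong) (auto simp: poly_monom a_def power_mult_distrib)
    moreover have "(of_int i + s) / real N = of_int i / real N + h * s"
      by (simp add: h_def add_divide_distrib)
    ultimately have "\<bar>poly (T i) s - u ((of_int i + s) / real N)\<bar> \<le> M * \<bar>h * s\<bar> ^ (k + 2)"
      using Cpm_taylor[OF u, of "of_int i / real N" "h * s"] by (simp only: M_def abs_minus_commute)
    also have "\<dots> \<le> M * h ^ (k + 2)"
      using h s M by (intro mult_left_mono power_mono) (auto simp: abs_mult mult_left_le)
    finally show ?thesis .
  qed
  have c_diff: "\<bar>c (i + 1) - c i\<bar> \<le> M * h ^ (k + 2)" for i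
  proof -
    have eq: "of_int (i + 1) / real N = of_int i / real N + h"
      by (simp add: h_def add_divide_distrib)
    have "\<bar>(deriv ^^ (k + 1)) u (of_int (i + 1) / real N) - (deriv ^^ (k + 1)) u (of_int i / real N)\<bar> \<le> M * h"
      unfolding eq using Cpm_lipschitz[of u "k + 1" "of_int i / real N" h] u h by (simp add: M_def)
    then have "h ^ (k + 1) * \<bar>(deriv ^^ (k + 1)) u (of_int (i + 1) / real N) - (deriv ^^ (k + 1)) u (of_int i / real N)\<bar>
        \<le> h ^ (k + 1) * (M * h)"
      using h by (intro mult_left_mono) auto
    then have *: "h ^ (k + 1) * \<bar>(deriv ^^ (k + 1)) u (of_int (i + 1) / real N) - (deriv ^^ (k + 1)) u (of_int i / real N)\<bar>
        \<le> M * h ^ (k + 2)" (is "?X \<le> _")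
      by (simp add: mult_ac)
    have "\<bar>c (i + 1) - c i\<bar> = ?X / fact (k + 1)"
    proof -
      have "c (i + 1) - c i = - (h ^ (k + 1) * ((deriv ^^ (k + 1)) u (of_int (i + 1) / real N)
          - (deriv ^^ (k + 1)) u (of_int i / real N)) / fact (k + 1))"
        by (simp only: c_def a_def right_diff_distrib diff_divide_distrib minus_diff_eq minus_diff_minus)
      then show ?thesis using h by (simp only: abs_minus_cancel abs_divide abs_mult) simp
    qed
    also have "\<dots> \<le> ?X" using divide_left_mono[of 1 "fact (k + 1)" ?X] h by (simp only: fact_ge_1) simp
    finally show ?thesis using * by linarith
  qed
  \<comment> \<open>Here the equal end values of \<open>L\<close> are used: the two multiples of
    \<open>L\<close> at a node combine to \<open>(c (i + 1) - c i) * poly L 0\<close>, and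
    \<open>c_diff\<close> supplies the additional power of h.\<close>
  have J_bound: "\<bar>J i\<bar> \<le> (1 + \<bar>poly L 0\<bar>) * (M * h ^ (k + 2))" for i
  proof -
    have "poly (T (i + 1)) 0 = u (of_int (i + 1) / real N)"
      by (simp add: poly_0_coeff_0 coeffT a_def)
    then have "J i = (u ((of_int i + 1) / real N) - poly (T i) 1) + (c (i + 1) - c i) * poly L 0"
      using L(3) by (simp add: J_def p0_def algebra_simps)
    also have "\<bar>\<dots>\<bar> \<le> M * h ^ (k + 2) + M * h ^ (k + 2) * \<bar>poly L 0\<bar>"
    proof (rule order.trans[OF abs_triangle_ineq], rule add_mono)
      show "\<bar>u ((of_int i + 1) / real N) - poly (T i) 1\<bar> \<le> M * h ^ (k + 2)"
        using T_err[of 1 i] by (simp add: abs_minus_commute)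
      show "\<bar>(c (i + 1) - c i) * poly L 0\<bar> \<le> M * h ^ (k + 2) * \<bar>poly L 0\<bar>"
        unfolding abs_mult by (intro mult_right_mono c_diff) simp
    qed
    finally show ?thesis by (simp add: algebra_simps)
  qed
  have "\<bar>v ((of_int i + s) / real N) - u ((of_int i + s) / real N) - c i * poly L s\<bar>
      \<le> (2 + \<bar>poly L 0\<bar>) * h ^ (k + 2) * M" if s: "s \<in> {0..1}" for i s
  proof -
    have "v ((of_int i + s) / real N) - u ((of_int i + s) / real N) - c i * poly L s
        = (poly (T i) s - u ((of_int i + s) / real N)) + J i * s"
      unfolding v(2)[OF s] by (simp add: p_def p0_def poly_monom)
    also have "\<bar>\<dots>\<bar> \<le> M * h ^ (k + 2) + (1 + \<bar>poly L 0\<bar>) * (M * h ^ (k + 2))"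
    proof (rule order.trans[OF abs_triangle_ineq], rule add_mono[OF T_err[OF s]])
      have "\<bar>J i * s\<bar> \<le> \<bar>J i\<bar>" using s by (simp add: abs_mult mult_left_le)
      then show "\<bar>J i * s\<bar> \<le> (1 + \<bar>poly L 0\<bar>) * (M * h ^ (k + 2))" using J_bound[of i] by linarith
    qed
    finally show ?thesis by (simp add: algebra_simps)
  qed
  from this[of _ "int _"] show ?thesis
    by (intro that[of v "\<lambda>i. c (int i)"] v(1)) (simp add: h_def M_def)
qed

lemma odd_degree_bound:
  assumes k: "odd k"
  shows "\<exists>C>0. \<forall>u\<in>Cpm (k + 2). \<forall>N::nat. N \<ge> 1 \<longrightarrow>
    L2norm (L2proj N k (proj_err_deriv N k u))
      \<le> C * (1 / real N) ^ (k + 1) * supnorm ((deriv ^^ (k + 2)) u)"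
proof -
  have k1: "k \<ge> 1" using k by (cases k) auto
  obtain L :: "real poly" where L: "degree L = k + 1" "coeff L (k + 1) = 1"
    "\<And>q. degree q \<le> k \<Longrightarrow> L2ip (poly L) (poly q) = 0" "poly L 1 = poly L 0"
    using orthogonal_polynomial[of k] k by blast
  obtain K where K: "K > 0"
    "\<And>p. degree p \<le> k \<Longrightarrow> L2ip (poly (pderiv p)) (poly (pderiv p)) \<le> K * L2ip (poly p) (poly p)"
    using inverse_inequality[of k] by blast
  define C where "C = sqrt K * (2 + \<bar>poly L 0\<bar>)"
  have "L2norm (L2proj N k (proj_err_deriv N k u))
      \<le> C * (1 / real N) ^ (k + 1) * supnorm ((deriv ^^ (k + 2)) u)"
    if u: "u \<in> Cpm (k + 2)" and N: "N \<ge> 1" for u N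
  proof -
    define B where "B = (2 + \<bar>poly L 0\<bar>) * (1 / real N) ^ (k + 2) * supnorm ((deriv ^^ (k + 2)) u)"
    have B: "B \<ge> 0" unfolding B_def
      by (intro mult_nonneg_nonneg supnorm_nonneg Cpm_deriv_in_Cp[OF u]) auto
    obtain v and c :: "nat \<Rightarrow> real" where v: "v \<in> Vh N k"
      "\<And>(i::nat) s. s \<in> {0..1} \<Longrightarrow> \<bar>v ((real i + s) / real N) - u ((real i + s) / real N) - c i * poly L s\<bar> \<le> B"
      unfolding B_def using quasi_interpolant[OF N k1 u L(1,2,4)] by blast
    have u1: "u \<in> Cpm 1" by (rule Cpm_mono[OF u]) simp
    have "L2norm (L2proj N k (proj_err_deriv N k u)) \<le> sqrt K * real N * B"
      by (rule L2norm_L2proj_proj_err_deriv_le[OF N k1 u1 v(1) K L(3) B v(2)])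
    also have "\<dots> = C * (real N * (1 / real N) ^ (k + 2)) * supnorm ((deriv ^^ (k + 2)) u)"
      unfolding B_def C_def by (simp only: mult_ac)
    also have "real N * (1 / real N) ^ (k + 2) = (1 / real N) ^ (k + 1)"
      using N by simp
    finally show ?thesis .
  qed
  moreover have "C > 0" unfolding C_def using K(1) by (intro mult_pos_pos) auto
  ultimately show ?thesis by blast
qed

subsection \<open>Linear elements\<close>

lemma sum_periodic_shift:
  fixes f :: "int \<Rightarrow> real"
  assumes "\<And>i. f (i + int N) = f i"
  shows "(\<Sum>i<N. f (int i + 1)) = (\<Sum>i<N. f (int i))"
proof -
  have "(\<Sum>i<N. f (int (Suc i)) - f (int i)) = f (int N) - f 0"
    using sum_lessThan_telescope[of "\<lambda>i. f (int i)" N] by simp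
  also have "\<dots> = 0" using assms[of 0] by simp
  finally show ?thesis by (simp add: sum_subtractf add.commute)
qed

lemma periodic_int_mod:
  fixes f :: "int \<Rightarrow> real"
  assumes N: "N \<ge> 1" and per: "\<And>i. f (i + int N) = f i"
  obtains j where "j < N" "f i = f (int j)"
proof
  have nat: "f (i + int m * int N) = f i" for i m
  proof (induction m)
    case (Suc m)
    then show ?case using per[of "i + int m * int N"] by (simp add: algebra_simps)
  qed simp
  define j where "j = nat (i mod int N)"
  have j: "int j = i mod int N" using N by (simp add: j_def)
  show "nat (i mod int N) < N" using N by (simp add: nat_less_iff)
  have i: "i = i mod int N + (i div int N) * int N" by simp
  show "f i = f (int (nat (i mod int N)))"
  proof (cases "i div int N \<ge> 0")
    case True
    then show ?thesis using nat[of "int j" "nat (i div int N)"] j i by (simp add: j_def)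
  next
    case False
    then have "i + int (nat (- (i div int N))) * int N = i mod int N"
      using i by (simp add: algebra_simps)
    then show ?thesis using nat[of i "nat (- (i div int N))"] j by (simp add: j_def)
  qed
qed

lemma periodic_eq_zero:
  fixes f :: "int \<Rightarrow> real"
  assumes "N \<ge> 1" "\<And>i. f (i + int N) = f i" "(\<Sum>i<N. f (int i) * f (int i)) = 0"
  shows "f i = 0"
proof -
  obtain j where j: "j < N" "f i = f (int j)" using periodic_int_mod[of N f i] assms(1,2) by blast
  have "\<forall>i\<in>{..<N}. f (int i) * f (int i) = 0"
    using assms(3) by (subst (asm) sum_nonneg_eq_0_iff) auto
  then show ?thesis using j by simp
qed

text \<open>Diagonal dominance of the mass matrix, evaluated at an index of maximal modulus.\<close>

lemma mass_matrix_stable: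
  fixes f :: "int \<Rightarrow> real"
  assumes "N \<ge> 1" "\<And>i. f (i + int N) = f i"
    and "\<And>i. \<bar>f (i - 1) + 4 * f i + f (i + 1)\<bar> \<le> 6 * \<epsilon>"
  shows "\<bar>f i\<bar> \<le> 3 * \<epsilon>"
proof -
  define m where "m = Max ((\<lambda>j. \<bar>f (int j)\<bar>) ` {..<N})"
  have fin: "finite ((\<lambda>j. \<bar>f (int j)\<bar>) ` {..<N})" "(\<lambda>j. \<bar>f (int j)\<bar>) ` {..<N} \<noteq> {}"
    using assms(1) by (auto simp: lessThan_empty_iff)
  have le: "\<bar>f i\<bar> \<le> m" for i
  proof -
    obtain j where "j < N" "f i = f (int j)" using periodic_int_mod[of N f i] assms(1,2) by blast
    then show ?thesis unfolding m_def using fin(1) by (auto intro!: Max_ge)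
  qed
  obtain j where "m = \<bar>f (int j)\<bar>" using Max_in[OF fin] by (auto simp: m_def)
  then have "m \<le> 3 * \<epsilon>"
    using assms(3)[of "int j"] le[of "int j - 1"] le[of "int j + 1"] by linarith
  then show ?thesis using le[of i] by linarith
qed

section \<open>Nodal values, test functions and cell moments of linear elements\<close>

lemma Vh1_cell:
  assumes "\<phi> \<in> Vh N 1" "N \<ge> 1" "s \<in> {0..1}"
  shows "\<phi> ((of_int i + s) / real N)
    = (1 - s) * \<phi> (of_int i / real N) + s * \<phi> (of_int (i + 1) / real N)"
proof -
  obtain p where p: "degree p \<le> 1" "\<And>s. s \<in> {0..1} \<Longrightarrow> \<phi> ((of_int i + s) / real N) = poly p s"
    using Vh_cell[OF assms(1,2)] by metis
  have "p = [:coeff p 0, coeff p 1:]"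
    using p(1) by (intro poly_eqI) (auto simp: coeff_pCons coeff_eq_0 split: nat.split)
  then have lin: "poly p s = coeff p 0 + coeff p 1 * s" for s
    by (metis mult.commute poly_pCons poly_0 add_0_right mult_zero_right)
  show ?thesis using p(2)[of 0] p(2)[of 1] p(2)[OF assms(3)] by (simp add: lin algebra_simps)
qed

text \<open>This replaces the hat functions. A nodal equation X = 0 is proved by testing with the
  element whose nodal values are the residual X itself, which turns the tested identity into a
  vanishing sum of squares.\<close>

lemma Vh1_nodal:
  fixes X :: "int \<Rightarrow> real"
  assumes "N \<ge> 1" "\<And>i. X (i + int N) = X i"
  obtains \<psi> where "\<psi> \<in> Vh N 1"
    "\<And>i s. s \<in> {0..1} \<Longrightarrow> \<psi> ((of_int i + s) / real N) = poly [:X i, X (i + 1) - X i:] s"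
proof (rule Vh_glue[of N "\<lambda>i. [:X i, X (i + 1) - X i:]" 1])
  show "[:X (i + int N), X (i + int N + 1) - X (i + int N):] = [:X i, X (i + 1) - X i:]" for i
    using assms(2)[of i] assms(2)[of "i + 1"] by (simp add: algebra_simps)
qed (use assms(1) that in auto)

text \<open>The weights 1 - s and s are the two local branches of a hat function. A cyclic shift of
  the sum collects what belongs to node i: the falling branch on cell i and the rising branch on
  cell i - 1. Periodicity of the moments comes from that of \<open>\<phi>\<close> by uniqueness of
  integrals.\<close>

lemma L2ip_Vh1:
  fixes X a b :: "int \<Rightarrow> real"
  assumes N: "N \<ge> 1" and \<phi>: "\<phi> \<in> Cp" and X: "\<And>i. X (i + int N) = X i"
    and \<psi>: "\<And>i s. s \<in> {0..1} \<Longrightarrow> \<psi> ((of_int i + s) / real N) = poly [:X i, X (i + 1) - X i:] s"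
    and a: "\<And>i. ((\<lambda>s. \<phi> ((of_int i + s) / real N) * (1 - s)) has_integral a i) {0..1}"
    and b: "\<And>i. ((\<lambda>s. \<phi> ((of_int i + s) / real N) * s) has_integral b i) {0..1}"
  shows "L2ip \<phi> \<psi> = (\<Sum>i<N. X (int i) * (a (int i) + b (int i - 1))) / real N"
    and "a (i + int N) = a i" and "b (i + int N) = b i"
proof -
  have shift: "\<phi> ((of_int (i + int N) + s) / real N) = \<phi> ((of_int i + s) / real N)" for i s
    using Cp_shift_cells[OF \<phi> N, of i 1 s] by simp
  show perb: "b (i + int N) = b i" for i
    using has_integral_unique[OF b[of i]] b[of "i + int N"] by (simp only: shift)
  show "a (i + int N) = a i" for i
    using has_integral_unique[OF a[of i]] a[of "i + int N"] by (simp only: shift)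
  have "L2ip \<phi> \<psi> = (\<Sum>i<N. X (int i) * a (int i) + X (int i + 1) * b (int i)) / real N"
  proof (rule L2ip_cells[OF N])
    fix i :: nat
    have "((\<lambda>s. X (int i) * (\<phi> ((of_int (int i) + s) / real N) * (1 - s))
        + X (int i + 1) * (\<phi> ((of_int (int i) + s) / real N) * s)) has_integral
        (X (int i) * a (int i) + X (int i + 1) * b (int i))) {0..1}"
      by (intro has_integral_add has_integral_mult_right a b)
    then show "((\<lambda>s. \<phi> ((real i + s) / real N) * \<psi> ((real i + s) / real N)) has_integral
        (X (int i) * a (int i) + X (int i + 1) * b (int i))) {0..1}"
    proof (rule has_integral_eq[rotated])
      fix s :: real assume "s \<in> {0..1}"
      then have "\<psi> ((real i + s) / real N) = X (int i) * (1 - s) + X (int i + 1) * s"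
        using \<psi>[of s "int i"] by (simp add: algebra_simps)
      then show "X (int i) * (\<phi> ((of_int (int i) + s) / real N) * (1 - s))
          + X (int i + 1) * (\<phi> ((of_int (int i) + s) / real N) * s)
        = \<phi> ((real i + s) / real N) * \<psi> ((real i + s) / real N)"
        by (simp only: of_int_of_nat_eq) (simp only: distrib_left mult_ac)
    qed
  qed
  also have "(\<Sum>i<N. X (int i) * a (int i) + X (int i + 1) * b (int i))
      = (\<Sum>i<N. X (int i) * a (int i)) + (\<Sum>i<N. X (int i) * b (int i - 1))"
  proof -
    have "X (i + int N) * b (i + int N - 1) = X i * b (i - 1)" for i
      using X[of i] perb[of "i - 1"] by (simp add: algebra_simps)
    from sum_periodic_shift[of "\<lambda>i. X i * b (i - 1)", OF this] show ?thesis
      by (simp add: sum.distrib)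
  qed
  finally show "L2ip \<phi> \<psi> = (\<Sum>i<N. X (int i) * (a (int i) + b (int i - 1))) / real N"
    by (simp add: sum.distrib distrib_left)
qed

lemma has_integral_by_antiderivative:
  fixes f g :: "real \<Rightarrow> real"
  assumes "\<And>s. (g has_real_derivative f s) (at s)"
  shows "(f has_integral g 1 - g 0) {0..1}"
proof (rule fundamental_theorem_of_calculus)
  show "(g has_vector_derivative f s) (at s within {0..1})" for s
    using assms[of s] unfolding has_real_derivative_iff_has_vector_derivative
    by (rule has_vector_derivative_at_within)
qed simp

text \<open>1/3 and 1/6 are the entries of the local mass matrix; two neighbouring cells assemble to
  the stencil (1, 4, 1)/6. The plain integral is included because derivatives of linear test
  functions are constant on a cell.\<close>

lemma Vh1_moments:
  assumes w: "w \<in> Vh N 1" and N: "N \<ge> 1"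
  defines "W \<equiv> \<lambda>i. w (of_int i / real N)"
  shows "((\<lambda>s. w ((of_int i + s) / real N) * (1 - s)) has_integral W i / 3 + W (i + 1) / 6) {0..1}"
    and "((\<lambda>s. w ((of_int i + s) / real N) * s) has_integral W i / 6 + W (i + 1) / 3) {0..1}"
    and "((\<lambda>s. w ((of_int i + s) / real N)) has_integral (W i + W (i + 1)) / 2) {0..1}"
proof -
  have eq: "w ((of_int i + s) / real N) = (1 - s) * W i + s * W (i + 1)" if "s \<in> {0..1}" for s
    using Vh1_cell[OF w N that] by (simp add: W_def)
  have "((\<lambda>s. ((1 - s) * W i + s * W (i + 1)) * (1 - s)) has_integral
      (\<lambda>s. (s - s\<^sup>2 + s ^ 3 / 3) * W i + (s\<^sup>2 / 2 - s ^ 3 / 3) * W (i + 1)) 1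
      - (\<lambda>s. (s - s\<^sup>2 + s ^ 3 / 3) * W i + (s\<^sup>2 / 2 - s ^ 3 / 3) * W (i + 1)) 0) {0..1}"
    by (rule has_integral_by_antiderivative)
      (auto intro!: derivative_eq_intros simp: power2_eq_square algebra_simps)
  then have "((\<lambda>s. ((1 - s) * W i + s * W (i + 1)) * (1 - s)) has_integral W i / 3 + W (i + 1) / 6) {0..1}"
    by simp
  then show "((\<lambda>s. w ((of_int i + s) / real N) * (1 - s)) has_integral W i / 3 + W (i + 1) / 6) {0..1}"
    by (rule has_integral_eq[rotated]) (simp only: eq)
  have "((\<lambda>s. ((1 - s) * W i + s * W (i + 1)) * s) has_integral
      (\<lambda>s. (s\<^sup>2 / 2 - s ^ 3 / 3) * W i + s ^ 3 / 3 * W (i + 1)) 1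
      - (\<lambda>s. (s\<^sup>2 / 2 - s ^ 3 / 3) * W i + s ^ 3 / 3 * W (i + 1)) 0) {0..1}"
    by (rule has_integral_by_antiderivative)
      (auto intro!: derivative_eq_intros simp: power2_eq_square algebra_simps)
  then have "((\<lambda>s. ((1 - s) * W i + s * W (i + 1)) * s) has_integral W i / 6 + W (i + 1) / 3) {0..1}"
    by simp
  then show "((\<lambda>s. w ((of_int i + s) / real N) * s) has_integral W i / 6 + W (i + 1) / 3) {0..1}"
    by (rule has_integral_eq[rotated]) (simp only: eq)
  have "((\<lambda>s. (1 - s) * W i + s * W (i + 1)) has_integral
      (\<lambda>s. (s - s\<^sup>2 / 2) * W i + s\<^sup>2 / 2 * W (i + 1)) 1
      - (\<lambda>s. (s - s\<^sup>2 / 2) * W i + s\<^sup>2 / 2 * W (i + 1)) 0) {0..1}"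
    by (rule has_integral_by_antiderivative)
      (auto intro!: derivative_eq_intros simp: power2_eq_square algebra_simps)
  then have "((\<lambda>s. (1 - s) * W i + s * W (i + 1)) has_integral (W i + W (i + 1)) / 2) {0..1}"
    by (simp add: add_divide_distrib)
  then show "((\<lambda>s. w ((of_int i + s) / real N)) has_integral (W i + W (i + 1)) / 2) {0..1}"
    by (rule has_integral_eq[rotated]) (simp only: eq)
qed

text \<open>Integration by parts expresses the moments of u exactly by nodal values of two
  successive antiderivatives, so the projection equation becomes a finite-difference relation. Each
  antiderivative taken in the local coordinate costs a factor N.\<close>

lemma antiderivative_moments:
  fixes u g G :: "real \<Rightarrow> real"
  assumes N: "N \<ge> 1"
    and G: "\<And>x. (G has_real_derivative g x) (at x)" and g: "\<And>x. (g has_real_derivative u x) (at x)"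
  defines "\<gamma> \<equiv> \<lambda>i. g (of_int i / real N)" and "\<Gamma> \<equiv> \<lambda>i. G (of_int i / real N)"
  shows "((\<lambda>s. u ((of_int i + s) / real N) * (1 - s)) has_integral
      (real N)\<^sup>2 * (\<Gamma> (i + 1) - \<Gamma> i) - real N * \<gamma> i) {0..1}"
    and "((\<lambda>s. u ((of_int i + s) / real N) * s) has_integral
      real N * \<gamma> (i + 1) - (real N)\<^sup>2 * (\<Gamma> (i + 1) - \<Gamma> i)) {0..1}"
    and "((\<lambda>s. u ((of_int i + s) / real N)) has_integral real N * (\<gamma> (i + 1) - \<gamma> i)) {0..1}"
proof -
  let ?y = "\<lambda>s. (of_int i + s) / real N"
  have y: "(?y has_real_derivative 1 / real N) (at s)" for s
    using N by (auto intro!: derivative_eq_intros)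
  note dG = DERIV_chain2[OF G y] and dg = DERIV_chain2[OF g y]
  have N0: "real N \<noteq> 0" using N by simp
  have "((\<lambda>s. u (?y s) * (1 - s)) has_integral
      (\<lambda>s. real N * g (?y s) * (1 - s) + (real N)\<^sup>2 * G (?y s)) 1
      - (\<lambda>s. real N * g (?y s) * (1 - s) + (real N)\<^sup>2 * G (?y s)) 0) {0..1}"
    by (rule has_integral_by_antiderivative)
      (rule DERIV_cong, (rule DERIV_add DERIV_diff DERIV_cmult DERIV_mult dG dg DERIV_const DERIV_ident)+,
        use N0 in \<open>simp add: power2_eq_square field_simps\<close>)
  then show "((\<lambda>s. u (?y s) * (1 - s)) has_integral
      (real N)\<^sup>2 * (\<Gamma> (i + 1) - \<Gamma> i) - real N * \<gamma> i) {0..1}"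
    by (simp add: \<gamma>_def \<Gamma>_def algebra_simps)
  have "((\<lambda>s. u (?y s) * s) has_integral
      (\<lambda>s. real N * g (?y s) * s - (real N)\<^sup>2 * G (?y s)) 1
      - (\<lambda>s. real N * g (?y s) * s - (real N)\<^sup>2 * G (?y s)) 0) {0..1}"
    by (rule has_integral_by_antiderivative)
      (rule DERIV_cong, (rule DERIV_add DERIV_diff DERIV_cmult DERIV_mult dG dg DERIV_const DERIV_ident)+,
        use N0 in \<open>simp add: power2_eq_square field_simps\<close>)
  then show "((\<lambda>s. u (?y s) * s) has_integral
      real N * \<gamma> (i + 1) - (real N)\<^sup>2 * (\<Gamma> (i + 1) - \<Gamma> i)) {0..1}"
    by (simp add: \<gamma>_def \<Gamma>_def algebra_simps)
  show "((\<lambda>s. u (?y s)) has_integral real N * (\<gamma> (i + 1) - \<gamma> i)) {0..1}"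
    using has_integral_by_antiderivative[OF DERIV_cmult[OF dg, of "real N"]] N0
    by (simp add: \<gamma>_def algebra_simps)
qed

section \<open>Antiderivatives, Simpson's defect and the fourth-order bound\<close>

lemma antiderivative_exists:
  fixes f :: "real \<Rightarrow> real"
  assumes "continuous_on UNIV f"
  obtains F where "\<And>x. (F has_real_derivative f x) (at x)"
proof -
  have "\<exists>F. \<forall>x::real. -\<infinity> < ereal x \<longrightarrow> ereal x < \<infinity> \<longrightarrow> (F has_vector_derivative f x) (at x)"
    using assms by (intro einterval_antiderivative) (auto simp: continuous_on_eq_continuous_at)
  then show ?thesis using that by (auto simp: has_real_derivative_iff_has_vector_derivative)
qed

text \<open>This is a second difference of the defect of Simpson's rule for \<open>\<integral> G'\<close>.\<close>

lemma simpson_second_difference: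
  fixes u g G :: "real \<Rightarrow> real"
  assumes u: "u \<in> Cpm 5" and h: "h > 0"
    and G: "\<And>x. (G has_real_derivative g x) (at x)" and g: "\<And>x. (g has_real_derivative u x) (at x)"
  shows "\<bar>3 * (G (y + 2 * h) - 2 * G (y + h) + 2 * G (y - h) - G (y - 2 * h))
    - h * (g (y - 2 * h) + 2 * g (y - h) - 6 * g y + 2 * g (y + h) + g (y + 2 * h))\<bar>
    \<le> 3072 * supnorm ((deriv ^^ 5) u) * h ^ 7"
proof -
  define M where "M = supnorm ((deriv ^^ 5) u)"
  have bound: "\<bar>(deriv ^^ 5) u x\<bar> \<le> M" for x
    unfolding M_def by (intro abs_le_supnorm Cpm_deriv_in_Cp[OF u]) simp
  then have M: "M \<ge> 0" using abs_ge_zero order.trans by blast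
  \<comment> \<open>The successive derivatives of \<open>G\<close>, with those of u starting at
    index 2. Hence \<open>d 7\<close> is the fifth derivative of u, the remainder term both for
    \<open>G\<close> at order 7 and for \<open>g\<close> at order 6.\<close>
  define d where "d j = (if j = 0 then G else if j = 1 then g else (deriv ^^ (j - 2)) u)" for j :: nat
  have d: "(d j has_real_derivative d (Suc j) x) (at x)" if "j < 7" for j x
  proof -
    consider "j = 0" | "j = 1" | "j \<ge> 2" by linarith
    then show ?thesis
    proof cases
      case 3
      then have "d j = (deriv ^^ (j - 2)) u" "d (Suc j) = (deriv ^^ Suc (j - 2)) u"
        by (auto simp: d_def Suc_diff_le[symmetric] simp del: funpow.simps)
      then show ?thesis using Cpm_has_derivative[OF u, of "j - 2"] that by simp
    qed (use G g in \<open>auto simp: d_def\<close>)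
  qed
  define a where "a j = d j y / fact j" for j
  have G_err: "\<bar>G (y + t) - (a 0 + a 1 * t + a 2 * t ^ 2 + a 3 * t ^ 3 + a 4 * t ^ 4 + a 5 * t ^ 5 + a 6 * t ^ 6)\<bar>
      \<le> M * \<bar>t\<bar> ^ 7" for t
  proof -
    have "\<forall>m s. m < 7 \<and> \<bar>s\<bar> \<le> \<bar>t\<bar> \<longrightarrow> ((\<lambda>t. d m (y + t)) has_real_derivative d (Suc m) (y + s)) (at s)"
      unfolding add.commute[of y] DERIV_shift[symmetric] using d by blast
    moreover have "(\<lambda>t. d 0 (y + t)) = (\<lambda>t. G (y + t))" by (simp add: d_def)
    ultimately obtain s where s: "G (y + t) = (\<Sum>m<7. d m (y + 0) / fact m * t ^ m) + d 7 (y + s) / fact 7 * t ^ 7"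
      using Maclaurin_bi_le[of "\<lambda>m t. d m (y + t)" "\<lambda>t. G (y + t)" 7 t] by blast
    have "\<bar>d 7 (y + s)\<bar> \<le> M" using bound[of "y + s"] by (simp add: d_def)
    then have "\<bar>d 7 (y + s) / fact 7\<bar> \<le> M" using M by (simp add: fact_numeral abs_divide)
    then have "\<bar>d 7 (y + s) / fact 7 * t ^ 7\<bar> \<le> M * \<bar>t\<bar> ^ 7"
      unfolding abs_mult power_abs by (rule mult_right_mono) simp
    then show ?thesis unfolding s by (simp add: a_def eval_nat_numeral)
  qed
  have g_err: "\<bar>g (y + t) - (a 1 + 2 * a 2 * t + 3 * a 3 * t ^ 2 + 4 * a 4 * t ^ 3 + 5 * a 5 * t ^ 4 + 6 * a 6 * t ^ 5)\<bar>
      \<le> M * \<bar>t\<bar> ^ 6" for t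
  proof -
    have "\<forall>m s. m < 6 \<and> \<bar>s\<bar> \<le> \<bar>t\<bar> \<longrightarrow> ((\<lambda>t. d (Suc m) (y + t)) has_real_derivative d (Suc (Suc m)) (y + s)) (at s)"
      unfolding add.commute[of y] DERIV_shift[symmetric] using d by simp
    moreover have "(\<lambda>t. d (Suc 0) (y + t)) = (\<lambda>t. g (y + t))" by (simp add: d_def)
    ultimately obtain s where s: "g (y + t) = (\<Sum>m<6. d (Suc m) (y + 0) / fact m * t ^ m) + d (Suc 6) (y + s) / fact 6 * t ^ 6"
      using Maclaurin_bi_le[of "\<lambda>m t. d (Suc m) (y + t)" "\<lambda>t. g (y + t)" 6 t] by blast
    have "\<bar>d (Suc 6) (y + s)\<bar> \<le> M" using bound[of "y + s"] by (simp add: d_def)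
    then have "\<bar>d (Suc 6) (y + s) / fact 6\<bar> \<le> M" using M by (simp add: fact_numeral abs_divide)
    then have "\<bar>d (Suc 6) (y + s) / fact 6 * t ^ 6\<bar> \<le> M * \<bar>t\<bar> ^ 6"
      unfolding abs_mult power_abs by (rule mult_right_mono) simp
    then show ?thesis unfolding s by (simp add: a_def eval_nat_numeral)
  qed
  define pG where "pG t = a 0 + a 1 * t + a 2 * t ^ 2 + a 3 * t ^ 3 + a 4 * t ^ 4 + a 5 * t ^ 5 + a 6 * t ^ 6" for t
  define pg where "pg t = a 1 + 2 * a 2 * t + 3 * a 3 * t ^ 2 + 4 * a 4 * t ^ 3 + 5 * a 5 * t ^ 4 + 6 * a 6 * t ^ 5" for t
  define RG where "RG t = G (y + t) - pG t" for t
  define Rg where "Rg t = g (y + t) - pg t" for t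
  \<comment> \<open>Reflection about y reverses the sign of the expression, so even powers in
    \<open>G\<close> cancel by symmetry and the weights have to balance only for t, t^3 and t^5. At
    t^7 they no longer do (756 against 924), so degree 6 is the limit.\<close>
  have exact: "3 * (pG (2 * h) - 2 * pG h + 2 * pG (- h) - pG (- (2 * h)))
      - h * (pg (- (2 * h)) + 2 * pg (- h) - 6 * pg 0 + 2 * pg h + pg (2 * h)) = 0"
    unfolding pG_def pg_def by (simp add: eval_nat_numeral algebra_simps)
  define q where "q = M * h ^ 7"
  have Rg0: "Rg 0 = 0" by (simp add: Rg_def pg_def a_def d_def)
  have eq: "3 * (G (y + 2 * h) - 2 * G (y + h) + 2 * G (y - h) - G (y - 2 * h))
      - h * (g (y - 2 * h) + 2 * g (y - h) - 6 * g y + 2 * g (y + h) + g (y + 2 * h))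
    = 3 * (RG (2 * h) - 2 * RG h + 2 * RG (- h) - RG (- (2 * h)))
      - (h * Rg (- (2 * h)) + 2 * (h * Rg (- h)) - 6 * (h * Rg 0) + 2 * (h * Rg h) + h * Rg (2 * h))"
    (is "?lhs = ?rhs")
    unfolding RG_def Rg_def using exact by (simp add: algebra_simps)
  have RG: "\<bar>RG t\<bar> \<le> 128 * q" if "\<bar>t\<bar> \<le> 2 * h" for t
  proof -
    have "\<bar>t\<bar> ^ 7 \<le> (2 * h) ^ 7" using that by (intro power_mono) auto
    then have "M * \<bar>t\<bar> ^ 7 \<le> M * (2 * h) ^ 7" using M by (rule mult_left_mono)
    also have "\<dots> = 128 * q" by (simp add: q_def power_mult_distrib)
    finally show ?thesis using G_err[of t] by (simp add: RG_def pG_def)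
  qed
  have Rg: "\<bar>h * Rg t\<bar> \<le> 64 * q" if "\<bar>t\<bar> \<le> 2 * h" for t
  proof -
    have "\<bar>t\<bar> ^ 6 \<le> (2 * h) ^ 6" using that by (intro power_mono) auto
    then have "M * \<bar>t\<bar> ^ 6 \<le> M * (2 * h) ^ 6" using M by (rule mult_left_mono)
    then have "\<bar>Rg t\<bar> \<le> M * (2 * h) ^ 6" using g_err[of t] by (simp add: Rg_def pg_def)
    then have "h * \<bar>Rg t\<bar> \<le> h * (M * (2 * h) ^ 6)" using h by (intro mult_left_mono) auto
    also have "\<dots> = 64 * q" by (simp add: q_def power_mult_distrib eval_nat_numeral)
    finally show ?thesis using h by (simp add: abs_mult)
  qed
  \<comment> \<open>The \<open>G\<close> remainders have total weight 18 and contribute at most 18 *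
    128 = 2304, the \<open>g\<close> remainders away from y have weight 6 and contribute at most 6 *
    64 = 384. The rounded value 3072 = 6 * 512 suits the stencil normalised by 6.\<close>
  have "\<bar>?rhs\<bar> \<le> 3072 * q"
    using RG[of "2 * h"] RG[of h] RG[of "- h"] RG[of "- (2 * h)"]
      Rg[of "2 * h"] Rg[of h] Rg[of "- h"] Rg[of "- (2 * h)"] Rg0 h by simp
  then show ?thesis unfolding eq by (simp only: q_def M_def mult.assoc)
qed

lemma linear_bound:
  assumes u: "u \<in> Cpm 5" and N: "N \<ge> 1"
  shows "L2norm (L2proj N 1 (proj_err_deriv N 1 u))
    \<le> 4608 * (1 / real N) ^ 4 * supnorm ((deriv ^^ 5) u)"
proof -
  define w where "w = L2proj N 1 u"
  define F where "F = L2proj N 1 (proj_err_deriv N 1 u)"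
  have u1: "u \<in> Cpm 1" by (rule Cpm_mono[OF u]) simp
  have uCp: "u \<in> Cp" using Cpm_deriv_in_Cp[OF u, of 0] by simp
  have w: "w \<in> Vh N 1" "\<And>\<psi>. \<psi> \<in> Vh N 1 \<Longrightarrow> L2ip (\<lambda>x. w x - u x) \<psi> = 0"
    unfolding w_def using L2proj_continuous[OF N order.refl uCp] by auto
  have F: "F \<in> Vh N 1" unfolding F_def by (rule L2proj_proj_err_deriv_in_Vh[OF N order.refl u1])
  \<comment> \<open>In general \<open>g\<close> and \<open>G\<close> are not periodic, since u may
    have nonzero mean. Periodicity of the cell quantities \<open>a\<close>, \<open>b\<close> and
    \<open>m\<close> is therefore derived from the error \<open>e\<close>, not from these
    formulas.\<close>
  obtain g where g: "\<And>x. (g has_real_derivative u x) (at x)"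
    using antiderivative_exists[of u] Cp_continuous_on[OF uCp] by blast
  have "continuous_on UNIV g"
    using g by (meson DERIV_isCont continuous_at_imp_continuous_on)
  then obtain G where G: "\<And>x. (G has_real_derivative g x) (at x)"
    using antiderivative_exists[of g] by blast
  define W \<Phi> \<gamma> \<Gamma> where "W i = w (of_int i / real N)" and "\<Phi> i = F (of_int i / real N)"
    and "\<gamma> i = g (of_int i / real N)" and "\<Gamma> i = G (of_int i / real N)" for i :: int
  define e where "e x = w x - u x" for x
  have e: "e \<in> Cp"
    using Cp_linear_combination[OF Vh_Cp[OF w(1)] uCp, of "-1"] by (simp add: e_def[abs_def])
  define a where "a i = W i / 3 + W (i + 1) / 6 - ((real N)\<^sup>2 * (\<Gamma> (i + 1) - \<Gamma> i) - real N * \<gamma> i)" for i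
  define b where "b i = W i / 6 + W (i + 1) / 3 - (real N * \<gamma> (i + 1) - (real N)\<^sup>2 * (\<Gamma> (i + 1) - \<Gamma> i))" for i
  define m where "m i = (W i + W (i + 1)) / 2 - real N * (\<gamma> (i + 1) - \<gamma> i)" for i
  note mw = Vh1_moments[OF w(1) N, folded W_def] and mu = antiderivative_moments[OF N G g, folded \<gamma>_def \<Gamma>_def]
  have ea: "((\<lambda>s. e ((of_int i + s) / real N) * (1 - s)) has_integral a i) {0..1}" for i
    using has_integral_diff[OF mw(1) mu(1), of i] by (simp only: a_def e_def left_diff_distrib)
  have eb: "((\<lambda>s. e ((of_int i + s) / real N) * s) has_integral b i) {0..1}" for i
    using has_integral_diff[OF mw(2) mu(2), of i] by (simp only: b_def e_def left_diff_distrib)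
  have em: "((\<lambda>s. e ((of_int i + s) / real N)) has_integral m i) {0..1}" for i
    using has_integral_diff[OF mw(3) mu(3), of i] by (simp only: m_def e_def)
  have perm: "m (i + int N) = m i" for i
    using has_integral_unique[OF em[of i]] em[of "i + int N"] Cp_shift_cells[OF e N, of i 1] by simp

  \<comment> \<open>The nodal form of the projection equation. At each node the
    \<open>\<gamma>\<close> terms of the two adjacent cells cancel, so only a second difference of
    \<open>\<Gamma>\<close> is left.\<close>
  have mass_w: "W (i - 1) + 4 * W i + W (i + 1) = 6 * (real N)\<^sup>2 * (\<Gamma> (i + 1) - 2 * \<Gamma> i + \<Gamma> (i - 1))" for i
  proof -
    define X where "X i = a i + b (i - 1)" for i
    \<comment> \<open>The zero sequence makes the periodicity of \<open>a\<close> and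
      \<open>b\<close> available; the residual \<open>X\<close> cannot serve yet, as its own
      periodicity rests on theirs.\<close>
    obtain \<psi>0 where "\<psi>0 \<in> Vh N 1"
      "\<And>i s. s \<in> {0..1} \<Longrightarrow> \<psi>0 ((of_int i + s) / real N) = poly [:0, 0 - 0:] s"
      using Vh1_nodal[of N "\<lambda>i. 0"] N by metis
    note per = L2ip_Vh1(2,3)[OF N e _ this(2) ea eb]
    have perX: "X (i + int N) = X i" for i
      using per(1)[of i] per(2)[of "i - 1"] by (simp add: X_def algebra_simps)
    obtain \<psi> where \<psi>: "\<psi> \<in> Vh N 1"
      "\<And>i s. s \<in> {0..1} \<Longrightarrow> \<psi> ((of_int i + s) / real N) = poly [:X i, X (i + 1) - X i:] s"
      using Vh1_nodal[of N X] N perX by metis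
    have "L2ip e \<psi> = 0" using w(2)[OF \<psi>(1)] by (simp add: e_def[abs_def])
    then have "(\<Sum>i<N. X (int i) * X (int i)) = 0"
      using L2ip_Vh1(1)[OF N e perX \<psi>(2) ea eb] N by (simp add: X_def)
    then have "X i = 0" using periodic_eq_zero[of N X i] N perX by blast
    then show ?thesis by (simp add: X_def a_def b_def algebra_simps)
  qed

  \<comment> \<open>The test function has slope X(i+1) - X(i) in the local coordinate of cell i, so
    the weak form sees only the cell means \<open>m\<close> of Pu - u; summation by parts moves the
    difference onto \<open>m\<close>.\<close>
  have mass_F: "\<Phi> (i - 1) + 4 * \<Phi> i + \<Phi> (i + 1) = 6 * real N * (m i - m (i - 1))" for i
  proof -
    note mF = Vh1_moments[OF F N, folded \<Phi>_def]
    define X where "X i = (\<Phi> (i - 1) + 4 * \<Phi> i + \<Phi> (i + 1)) / 6 - real N * (m i - m (i - 1))" for i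
    have per\<Phi>: "\<Phi> (i + int N) = \<Phi> i" for i
      using Cp_shift_cells[OF Vh_Cp[OF F] N, of i 1 0] by (simp add: \<Phi>_def)
    have perX: "X (i + int N) = X i" for i
      using per\<Phi>[of i] per\<Phi>[of "i - 1"] per\<Phi>[of "i + 1"] perm[of i] perm[of "i - 1"]
      by (simp add: X_def algebra_simps)
    obtain \<psi> where \<psi>: "\<psi> \<in> Vh N 1"
      "\<And>i s. s \<in> {0..1} \<Longrightarrow> \<psi> ((of_int i + s) / real N) = poly [:X i, X (i + 1) - X i:] s"
      using Vh1_nodal[of N X] N perX by metis
    have "L2ip F \<psi> = (\<Sum>i<N. X (int i) * ((\<Phi> (int i) / 3 + \<Phi> (int i + 1) / 6)
        + (\<Phi> (int i - 1) / 6 + \<Phi> (int i - 1 + 1) / 3))) / real N"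
      by (rule L2ip_Vh1(1)[OF N Vh_Cp[OF F] perX \<psi>(2) mF(1) mF(2)])
    also have "\<dots> = (\<Sum>i<N. X (int i) * ((\<Phi> (int i - 1) + 4 * \<Phi> (int i) + \<Phi> (int i + 1)) / 6)) / real N"
      by (intro arg_cong[where f = "\<lambda>x. x / real N"] sum.cong refl) (simp add: algebra_simps)
    finally have 1: "real N * L2ip F \<psi>
        = (\<Sum>i<N. X (int i) * ((\<Phi> (int i - 1) + 4 * \<Phi> (int i) + \<Phi> (int i + 1)) / 6))"
      using N by simp
    have "L2ip F \<psi> = - (\<Sum>i<N. integral {0..1} (\<lambda>s. (w ((real i + s) / real N) - u ((real i + s) / real N))
        * poly (pderiv [:X (int i), X (int i + 1) - X (int i):]) s))"
      unfolding F_def w_def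
      by (rule L2ip_L2proj_proj_err_deriv[OF N order.refl u1 \<psi>(1)])
        (use \<psi>(2)[of _ "int _"] in simp)
    also have "\<dots> = - (\<Sum>i<N. m (int i) * (X (int i + 1) - X (int i)))"
    proof (intro arg_cong[where f = uminus] sum.cong refl)
      fix i
      show "integral {0..1} (\<lambda>s. (w ((real i + s) / real N) - u ((real i + s) / real N))
          * poly (pderiv [:X (int i), X (int i + 1) - X (int i):]) s) = m (int i) * (X (int i + 1) - X (int i))"
        using integral_unique[OF has_integral_mult_left[OF em[of "int i"], of "X (int i + 1) - X (int i)"]]
        by (simp add: e_def pderiv_pCons)
    qed
    also have "\<dots> = (\<Sum>i<N. X (int i) * (m (int i) - m (int i - 1)))"
    proof -
      have "m (i + int N - 1) * X (i + int N) = m (i - 1) * X i" for i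
        using perm[of "i - 1"] perX[of i] by (simp add: algebra_simps)
      from sum_periodic_shift[of "\<lambda>i. m (i - 1) * X i", OF this]
      have "(\<Sum>i<N. m (int i) * X (int i + 1)) = (\<Sum>i<N. m (int i - 1) * X (int i))" by simp
      then show ?thesis by (simp add: right_diff_distrib left_diff_distrib sum_subtractf mult.commute)
    qed
    finally have 2: "real N * L2ip F \<psi> = (\<Sum>i<N. X (int i) * (real N * (m (int i) - m (int i - 1))))"
      by (simp add: sum_distrib_left mult_ac)
    have "(\<Sum>i<N. X (int i) * X (int i))
        = (\<Sum>i<N. X (int i) * ((\<Phi> (int i - 1) + 4 * \<Phi> (int i) + \<Phi> (int i + 1)) / 6)
            - X (int i) * (real N * (m (int i) - m (int i - 1))))"
      by (intro sum.cong refl) (simp add: X_def right_diff_distrib)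
    also have "\<dots> = 0" unfolding sum_subtractf 1[symmetric] 2[symmetric] by simp
    finally have "X i = 0" using periodic_eq_zero[of N X i] N perX by blast
    then show ?thesis by (simp add: X_def)
  qed

  define h where "h = 1 / real N"
  have h: "h > 0" and Nh: "real N * h = 1" using N by (simp_all add: h_def)
  define M where "M = supnorm ((deriv ^^ 5) u)"
  have M: "M \<ge> 0" unfolding M_def by (intro supnorm_nonneg Cpm_deriv_in_Cp[OF u]) simp
  define r where "r i = m i - m (i - 1)" for i
  \<comment> \<open>In \<open>r\<close> the values of \<open>W\<close> occur as half of W(i+1) -
    W(i-1). The stencil commutes with this difference, so \<open>mass_w\<close> at i + 1 and at i -
    1 removes \<open>W\<close> altogether and leaves the Simpson expression times
    \<open>(real N)\<^sup>2\<close>.\<close>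
  have r_mass: "\<bar>r (i - 1) + 4 * r i + r (i + 1)\<bar> \<le> 6 * (512 * M * h ^ 5)" for i
  proof -
    define y where "y = of_int i / real N"
    have nodes: "\<gamma> i = g y" "\<gamma> (i + 1) = g (y + h)" "\<gamma> (i - 1) = g (y - h)"
      "\<gamma> (i + 2) = g (y + 2 * h)" "\<gamma> (i - 2) = g (y - 2 * h)"
      "\<Gamma> (i + 1) = G (y + h)" "\<Gamma> (i - 1) = G (y - h)"
      "\<Gamma> (i + 2) = G (y + 2 * h)" "\<Gamma> (i - 2) = G (y - 2 * h)"
      by (simp_all add: \<gamma>_def \<Gamma>_def y_def h_def add_divide_distrib diff_divide_distrib)
    have "r (i - 1) + 4 * r i + r (i + 1)
        = ((W i + 4 * W (i + 1) + W (i + 2)) - (W (i - 2) + 4 * W (i - 1) + W i)) / 2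
          - real N * (\<gamma> (i - 2) + 2 * \<gamma> (i - 1) - 6 * \<gamma> i + 2 * \<gamma> (i + 1) + \<gamma> (i + 2))"
      by (simp add: r_def m_def field_simps)
    also have "W i + 4 * W (i + 1) + W (i + 2) = 6 * (real N)\<^sup>2 * (\<Gamma> (i + 2) - 2 * \<Gamma> (i + 1) + \<Gamma> i)"
      using mass_w[of "i + 1"] by (simp add: algebra_simps)
    also have "W (i - 2) + 4 * W (i - 1) + W i = 6 * (real N)\<^sup>2 * (\<Gamma> i - 2 * \<Gamma> (i - 1) + \<Gamma> (i - 2))"
      using mass_w[of "i - 1"] by (simp add: algebra_simps)
    finally have "r (i - 1) + 4 * r i + r (i + 1)
        = (real N)\<^sup>2 * (3 * (\<Gamma> (i + 2) - 2 * \<Gamma> (i + 1) + 2 * \<Gamma> (i - 1) - \<Gamma> (i - 2)))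
          - real N * (\<gamma> (i - 2) + 2 * \<gamma> (i - 1) - 6 * \<gamma> i + 2 * \<gamma> (i + 1) + \<gamma> (i + 2))"
      by (simp add: field_simps)
    also have "real N * (\<gamma> (i - 2) + 2 * \<gamma> (i - 1) - 6 * \<gamma> i + 2 * \<gamma> (i + 1) + \<gamma> (i + 2))
        = (real N)\<^sup>2 * (h * (\<gamma> (i - 2) + 2 * \<gamma> (i - 1) - 6 * \<gamma> i + 2 * \<gamma> (i + 1) + \<gamma> (i + 2)))"
      by (simp add: h_def power2_eq_square)
    finally have "r (i - 1) + 4 * r i + r (i + 1) = (real N)\<^sup>2 *
        (3 * (G (y + 2 * h) - 2 * G (y + h) + 2 * G (y - h) - G (y - 2 * h))
        - h * (g (y - 2 * h) + 2 * g (y - h) - 6 * g y + 2 * g (y + h) + g (y + 2 * h)))"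
      unfolding nodes by (simp only: right_diff_distrib)
    then have "\<bar>r (i - 1) + 4 * r i + r (i + 1)\<bar> \<le> (real N)\<^sup>2 * (3072 * M * h ^ 7)"
      using mult_left_mono[OF simpson_second_difference[OF u h G g, of y], of "(real N)\<^sup>2"]
      by (simp add: abs_mult M_def)
    also have "\<dots> = 3072 * M * h ^ 5 * (real N * h)\<^sup>2"
      by (simp add: power_mult_distrib eval_nat_numeral)
    finally show ?thesis by (simp add: Nh)
  qed
  have perr: "r (i + int N) = r i" for i
    using perm[of i] perm[of "i - 1"] by (simp add: r_def algebra_simps)
  have r_bound: "\<bar>r i\<bar> \<le> 1536 * M * h ^ 5" for i
    using mass_matrix_stable[OF N perr r_mass, of i] by simp
  have "\<bar>\<Phi> (i - 1) + 4 * \<Phi> i + \<Phi> (i + 1)\<bar> \<le> 6 * (1536 * M * h ^ 4)" for i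
  proof -
    have "\<bar>\<Phi> (i - 1) + 4 * \<Phi> i + \<Phi> (i + 1)\<bar> = 6 * real N * \<bar>r i\<bar>"
      unfolding mass_F r_def[symmetric] by (simp add: abs_mult)
    also have "\<dots> \<le> 6 * real N * (1536 * M * h ^ 5)" by (intro mult_left_mono r_bound) simp
    also have "\<dots> = 6 * (1536 * M * h ^ 4) * (real N * h)" by (simp add: eval_nat_numeral)
    finally show ?thesis by (simp add: Nh)
  qed
  moreover have "\<Phi> (i + int N) = \<Phi> i" for i
    using Cp_shift_cells[OF Vh_Cp[OF F] N, of i 1 0] by (simp add: \<Phi>_def)
  ultimately have \<Phi>_bound: "\<bar>\<Phi> i\<bar> \<le> 3 * (1536 * M * h ^ 4)" for i
    using N by (intro mass_matrix_stable[of N]) auto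
  \<comment> \<open>4608 = 3 * 3 * 512: the stencil bound 3072/6, followed by one factor 3 for each
    of the two inversions of the mass matrix. A linear element is bounded by its nodal values, and
    on a unit interval the sup norm dominates the norm of \<open>L2norm\<close>.\<close>
  define B where "B = 4608 * h ^ 4 * M"
  have B: "B \<ge> 0" using h M by (simp add: B_def)
  have F_bound: "\<bar>F x\<bar> \<le> B" for x
  proof -
    define i where "i = \<lfloor>real N * x\<rfloor>"
    define s where "s = frac (real N * x)"
    have s: "s \<in> {0..1}" using frac_lt_1[of "real N * x"] by (simp add: s_def)
    have "x = (of_int i + s) / real N" using N by (simp add: i_def s_def frac_def)
    then have "F x = (1 - s) * \<Phi> i + s * \<Phi> (i + 1)"
      using Vh1_cell[OF F N s, of i] by (simp add: \<Phi>_def)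
    also have "\<bar>\<dots>\<bar> \<le> \<bar>(1 - s) * \<Phi> i\<bar> + \<bar>s * \<Phi> (i + 1)\<bar>" by (rule abs_triangle_ineq)
    also have "\<dots> = (1 - s) * \<bar>\<Phi> i\<bar> + s * \<bar>\<Phi> (i + 1)\<bar>" using s by (simp add: abs_mult)
    also have "\<dots> \<le> (1 - s) * B + s * B"
      using s \<Phi>_bound[of i] \<Phi>_bound[of "i + 1"]
      by (intro add_mono mult_left_mono) (auto simp: B_def mult_ac)
    finally show ?thesis by (simp add: algebra_simps)
  qed
  have "L2ip F F \<le> integral {0..1} (\<lambda>x::real. B\<^sup>2)"
    unfolding L2ip_def
  proof (rule integral_le)
    show "(\<lambda>x. F x * F x) integrable_on {0..1}"
      by (intro continuous_mult_integrable Cp_continuous_on Vh_Cp[OF F])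
    show "F x * F x \<le> B\<^sup>2" for x
      using F_bound[of x] B by (metis abs_le_square_iff abs_of_nonneg power2_eq_square)
  qed (rule integrable_const_ivl)
  then have "sqrt (L2ip F F) \<le> B" using B by (intro real_le_lsqrt) auto
  then show ?thesis by (simp add: L2norm_eq_L2ip F_def B_def M_def h_def)
qed

theorem theorem2p8:
  fixes k :: nat
  assumes "k \<ge> 1"
  shows "(odd k \<longrightarrow>
           (\<exists>C>0. \<forall>u\<in>Cpm (k + 2). \<forall>N::nat. N \<ge> 1 \<longrightarrow>
              L2norm (L2proj N k (proj_err_deriv N k u))
                \<le> C * (1 / real N) ^ (k + 1) * supnorm ((deriv ^^ (k + 2)) u)))
       \<and> (k = 1 \<longrightarrow>
           (\<exists>C>0. \<forall>u\<in>Cpm 5. \<forall>N::nat. N \<ge> 1 \<longrightarrow>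
              L2norm (L2proj N k (proj_err_deriv N k u))
                \<le> C * (1 / real N) ^ 4 * supnorm ((deriv ^^ 5) u)))"
proof (intro conjI impI)
  assume "odd k"
  then show "\<exists>C>0. \<forall>u\<in>Cpm (k + 2). \<forall>N::nat. N \<ge> 1 \<longrightarrow>
      L2norm (L2proj N k (proj_err_deriv N k u))
        \<le> C * (1 / real N) ^ (k + 1) * supnorm ((deriv ^^ (k + 2)) u)"
    by (rule odd_degree_bound)
next
  assume "k = 1"
  then show "\<exists>C>0. \<forall>u\<in>Cpm 5. \<forall>N::nat. N \<ge> 1 \<longrightarrow>
      L2norm (L2proj N k (proj_err_deriv N k u))
        \<le> C * (1 / real N) ^ 4 * supnorm ((deriv ^^ 5) u)"
    using linear_bound by (intro exI[of _ 4608]) simp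
qed

end
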